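(* Let $d\ge3$ and $h_0\ge1$. For the flashing process on $\mathbb{Z}^d$ with parameter $h_0$, with probability $1$, $$\lim_{n\to\infty}\frac{n^{\frac1{d+1}}}{\delta_I^*(n)}=0,$$ where $\delta_I^*(n)$ is the inner error of the flashing cluster formed by $|\mathbb{B}(0,n)|$ explorers.
   Context: Notation. $\|\cdot\|$ is the Euclidean norm, $B(x,r)=\{y\in\mathbb{R}^d:\|y-x\|<r\}$, $\mathbb{B}(x,r)=B(x,r)\cap\mathbb{Z}^d$, $\mathbb{A}(r,R)=(B(0,R)\setminus B(0,r))\cap\mathbb{Z}^d$, $|\Lambda|$ is the number of sites of $\Lambda\subset\mathbb{Z}^d$. Sites $z,z'\in\mathbb{Z}^d$ are nearest neighbors ($z\sim z'$) if $\|z-z'\|=1$; for $\Lambda\subset\mathbb{Z}^d$, $\partial\Lambda=\{z\in\mathbb{Z}^d\setminus\Lambda:\exists z'\in\Lambda,\ z'\sim z\}$. For a path $\gamma$, $H(\Lambda;\gamma)=\min\{t\ge0:\gamma(t)\in\Lambda\}$, abbreviated $H(\Lambda)$. Shells. Given the parameter $h_0$, set $r_0=0$ and $\mathcal{S}_0=\mathbb{B}(0,h_0)$. Define $r_j,h_j$ for $j\ge1$ inductively by $r_1-h_1=h_0$, $r_{j+1}-h_{j+1}=r_j+h_j$, and $h_j=r_j^{1/(d+1)}$ (with $r_j>1$). For $j\ge1$ set $\mathcal{S}_j=\mathbb{A}(r_j-h_j,r_j+h_j)$. Set $\Sigma_0=\{0\}$ and $\Sigma_j=\partial\mathbb{B}(0,r_j)$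 for $j\ge1$. Cells. For $z\in\Sigma_j$, $\mathcal{C}(z)=\mathcal{S}_j\cap\{x\in\mathbb{R}^d:\exists\lambda\ge0,\ \exists y\in B(z,h_j/2),\ x=\lambda y\}$. Flashing times. Let $X_j,Y_j,R_j$ ($j\ge0$) be independent, independent of the random walk, with $X_j,Y_j$ Bernoulli, $P(X_j=1)=1/h_j^d$, $P(Y_0=1)=1$, $P(Y_j=1)=1/2$ for $j\ge1$, and $R_j$ with density $g_j(h)=d\,h^{d-1}/h_j^d$ on $[0,h_j]$. For a walk $S$ started at $z_j\in\Sigma_j$, and with $R_j=h$, define $\sigma=0$ if $X_j=1$; $\sigma=H\big(\mathbb{B}(z_j,h\wedge(r_j+h_j-\|z_j\|))^c\big)$ if $X_j=0,Y_j=1$; $\sigma=H\big(\mathbb{A}(r_j-h,r_j+h)^c\big)$ if $X_j=0,Y_j=0$. For a walk $S$ started at $0$ set $H_j=H(\Sigma_j)$ and $\sigma_j=H_j+\sigma(S\circ\theta_{H_j})$, where $\theta$ is the time shift and $\sigma$ is computed with $(X_j,Y_j,R_j)$ for the starting point $S(H_j)\in\Sigma_j$. Flashing process. Let $S_1^*,S_2^*,\dots$ be independent simple random walks started at $0$, each equipped with its own independent copy of the variables $(X_j,Y_j,R_j)_{j\ge0}$, giving hitting times $H_{i,j}$, positions $z_{i,j}=S_i^*(H_{i,j})$ and times $\sigma_{i,j}$. Set $\mathcal{A}^*(0)=\emptyset$ and for $i\ge1$ $$\tau_i^*=\min\{\sigma_{i,j}:\ j\ge0,\ S_i^*(\sigma_{i,j})\in\mathcal{C}(z_{i,j})\cap\mathcal{A}^*(i-1)^c\},\qquad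 \mathcal{A}^*(i)=\mathcal{A}^*(i-1)\cup\{S_i^*(\tau_i^* )\}.$$ Inner error. For integers $n\ge1$, $n-\delta^*_I(n)=\sup\{r\ge 0:\ \mathbb{B}(0,r)\subset \mathcal{A}^*(|\mathbb{B}(0,n)|)\}$. *)

theory Defs
  imports "HOL-Probability.Probability"
begin

section \<open>Lattice geometry\<close>

definition rpt :: "int ^ 'd \<Rightarrow> real ^ 'd" where
  "rpt z = (\<chi> i. real_of_int (z $ i))"

definition zball :: "real ^ 'd \<Rightarrow> real \<Rightarrow> (int ^ 'd) set" where
  "zball x r = {z. rpt z \<in> ball x r}"

definition annulus :: "real \<Rightarrow> real \<Rightarrow> (int ^ 'd) set" where
  "annulus r R = {z. rpt z \<in> ball 0 R - ball 0 r}"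

definition nbr :: "int ^ 'd \<Rightarrow> int ^ 'd \<Rightarrow> bool" where
  "nbr z z' \<longleftrightarrow> norm (rpt z - rpt z') = 1"

definition outer_boundary :: "(int ^ 'd) set \<Rightarrow> (int ^ 'd) set" where
  "outer_boundary L = {z. z \<notin> L \<and> (\<exists>z'\<in>L. nbr z' z)}"

text \<open>The value is \<open>\<infinity>\<close> for a path that never hits the set.\<close>

definition hit :: "'s set \<Rightarrow> (nat \<Rightarrow> 's) \<Rightarrow> enat" where
  "hit L \<gamma> = (INF t\<in>{t. \<gamma> t \<in> L}. enat t)"


section \<open>Shells and cells\<close>

text \<open>\<open>shell_params d h0 j\<close> is the pair \<open>(r\<^sub>j, h\<^sub>j)\<close>. As \<open>r\<^sub>0 + h\<^sub>0 = h\<^sub>0\<close>, the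
  condition \<open>r\<^sub>1 - h\<^sub>1 = h\<^sub>0\<close> is the case \<open>j = 0\<close> of \<open>r\<^bsub>j+1\<^esub> - h\<^bsub>j+1\<^esub> = r\<^sub>j + h\<^sub>j\<close>.
  The description is well defined for \<open>h0 \<ge> 1\<close>: see \<open>shell_recursion\<close> below.\<close>

primrec shell_params :: "nat \<Rightarrow> real \<Rightarrow> nat \<Rightarrow> real \<times> real" where
  "shell_params d h0 0 = (0, h0)"
| "shell_params d h0 (Suc j) =
     (let r = (THE r. r > 1 \<and> r - r powr (1 / (real d + 1))
                         = fst (shell_params d h0 j) + snd (shell_params d h0 j))
      in (r, r powr (1 / (real d + 1))))"

definition shell_r :: "nat \<Rightarrow> real \<Rightarrow> nat \<Rightarrow> real" where
  "shell_r d h0 j = fst (shell_params d h0 j)"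

definition shell_h :: "nat \<Rightarrow> real \<Rightarrow> nat \<Rightarrow> real" where
  "shell_h d h0 j = snd (shell_params d h0 j)"

lemma shell_radius_ex1:
  fixes a :: real and d :: nat
  assumes "a > 0" "d \<ge> 1"
  shows "\<exists>!r. r > 1 \<and> r - r powr (1 / (real d + 1)) = a"
proof -
  define p where "p = 1 / (real d + 1)"
  have p: "0 < p" "p \<le> 1 / 2"
    using assms by (auto simp: p_def field_simps)
  define f where "f = (\<lambda>r::real. r - r powr p)"
  have less: "f x < f y" if "1 \<le> x" "x < y" for x y
  proof (rule DERIV_pos_imp_increasing[OF \<open>x < y\<close>])
    fix z assume z: "x \<le> z" "z \<le> y"
    have "(f has_real_derivative (1 - p * z powr (p - 1))) (at z)"
      unfolding f_def using z that by (auto intro!: derivative_eq_intros)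
    moreover have "z powr (p - 1) \<le> 1"
      using powr_mono[of "p - 1" 0 z] z that p by auto
    then have "p * z powr (p - 1) \<le> p * 1"
      using p by (intro mult_left_mono) auto
    then have "1 - p * z powr (p - 1) > 0"
      using p by linarith
    ultimately show "\<exists>D. (f has_real_derivative D) (at z) \<and> D > 0" by blast
  qed
  define b where "b = (2 * a + 2)\<^sup>2"
  have b1: "b \<ge> 1" unfolding b_def using assms by (intro one_le_power) auto
  have "b powr p \<le> b powr (1/2)" using b1 p by (intro powr_mono) auto
  also have "\<dots> = 2 * a + 2" unfolding b_def using assms by (simp add: powr_half_sqrt)
  finally have "b powr p \<le> 2 * a + 2" .
  moreover have "b = 4 * (a * a) + 8 * a + 4"
    by (simp add: b_def power2_eq_square algebra_simps)
  moreover have "a * a \<ge> 0" by simp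
  ultimately have "a \<le> f b"
    unfolding f_def using assms(1) by linarith
  moreover have "f 1 \<le> a" using assms by (simp add: f_def)
  moreover have "continuous_on {1..b} f"
    unfolding f_def by (intro continuous_intros) auto
  ultimately obtain r where r: "1 \<le> r" "r \<le> b" "f r = a"
    using IVT'[of f 1 a b] b1 by auto
  have "r \<noteq> 1" using r assms by (auto simp: f_def)
  with r have "r > 1 \<and> f r = a" by simp
  moreover have "s = r" if "s > 1 \<and> f s = a" for s
    using less[of s r] less[of r s] that r by (cases s r rule: linorder_cases) auto
  ultimately show ?thesis unfolding f_def p_def by blast
qed

lemma shell_recursion:
  assumes "h0 \<ge> 1" "d \<ge> 1"
  shows "shell_r d h0 0 = 0" "shell_h d h0 0 = h0"
    and "shell_r d h0 (Suc j) > 1"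
    and "shell_h d h0 (Suc j) = shell_r d h0 (Suc j) powr (1 / (real d + 1))"
    and "shell_r d h0 (Suc j) - shell_h d h0 (Suc j) = shell_r d h0 j + shell_h d h0 j"
proof -
  show "shell_r d h0 0 = 0" "shell_h d h0 0 = h0"
    by (simp_all add: shell_r_def shell_h_def)
  have step: "shell_r d h0 (Suc j) > 1
      \<and> shell_r d h0 (Suc j) - shell_r d h0 (Suc j) powr (1 / (real d + 1))
          = shell_r d h0 j + shell_h d h0 j"
    if "shell_r d h0 j + shell_h d h0 j > 0" for j
    using theI'[OF shell_radius_ex1[OF that \<open>d \<ge> 1\<close>]]
    by (simp add: shell_r_def shell_h_def Let_def)
  show h: "shell_h d h0 (Suc j) = shell_r d h0 (Suc j) powr (1 / (real d + 1))" for j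
    by (simp add: shell_r_def shell_h_def Let_def)
  have pos: "shell_r d h0 j + shell_h d h0 j > 0" for j
  proof (induction j)
    case 0
    then show ?case using assms by (simp add: shell_r_def shell_h_def)
  next
    case (Suc j)
    then show ?case using step[OF Suc] h[of j] by (simp add: add_pos_nonneg)
  qed
  show "shell_r d h0 (Suc j) > 1"
    "shell_r d h0 (Suc j) - shell_h d h0 (Suc j) = shell_r d h0 j + shell_h d h0 j"
    using step[OF pos] h by auto
qed

definition shell :: "real \<Rightarrow> nat \<Rightarrow> (int ^ 'd) set" where
  "shell h0 j =
     (if j = 0 then zball 0 h0
      else annulus (shell_r CARD('d) h0 j - shell_h CARD('d) h0 j)
                   (shell_r CARD('d) h0 j + shell_h CARD('d) h0 j))"

definition Sigma_set :: "real \<Rightarrow> nat \<Rightarrow> (int ^ 'd) set" where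
  "Sigma_set h0 j = (if j = 0 then {0} else outer_boundary (zball 0 (shell_r CARD('d) h0 j)))"

definition cell :: "real \<Rightarrow> nat \<Rightarrow> int ^ 'd \<Rightarrow> (int ^ 'd) set" where
  "cell h0 j z =
     {x \<in> shell h0 j. \<exists>l\<ge>0. \<exists>y\<in>ball (rpt z) (shell_h CARD('d) h0 j / 2). rpt x = l *\<^sub>R y}"


section \<open>Flashing process\<close>

text \<open>In this section \<open>x\<close>, \<open>y\<close>, \<open>h\<close> stand for the values of \<open>X\<^sub>j\<close>, \<open>Y\<^sub>j\<close>, \<open>R\<^sub>j\<close>, with
  \<open>True\<close> for \<open>1\<close>. \<open>flash_time\<close> is \<open>\<sigma>\<close> and \<open>flash_time_at\<close> is \<open>\<sigma>\<^sub>j = H\<^sub>j + \<sigma>(S \<circ> \<theta>)\<close>.\<close>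

definition flash_time ::
    "real \<Rightarrow> nat \<Rightarrow> bool \<Rightarrow> bool \<Rightarrow> real \<Rightarrow> (nat \<Rightarrow> int ^ 'd) \<Rightarrow> enat" where
  "flash_time h0 j x y h \<gamma> =
     (let r = shell_r CARD('d) h0 j; w = shell_h CARD('d) h0 j; z = rpt (\<gamma> 0) in
      if x then 0
      else if y then hit (- zball z (min h (r + w - norm z))) \<gamma>
      else hit (- annulus (r - h) (r + h)) \<gamma>)"

definition flash_time_at ::
    "real \<Rightarrow> nat \<Rightarrow> bool \<Rightarrow> bool \<Rightarrow> real \<Rightarrow> (nat \<Rightarrow> int ^ 'd) \<Rightarrow> enat" where
  "flash_time_at h0 j x y h \<gamma> =
     (case hit (Sigma_set h0 j) \<gamma> of
        enat k \<Rightarrow> enat k + flash_time h0 j x y h (\<lambda>t. \<gamma> (k + t))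
      | \<infinity> \<Rightarrow> \<infinity>)"

text \<open>\<open>\<tau>\<^sup>*\<close> for an explorer with path \<open>\<gamma>\<close> when the set \<open>A\<close> is already occupied.\<close>

definition settle_time ::
    "real \<Rightarrow> (int ^ 'd) set \<Rightarrow> (nat \<Rightarrow> bool) \<Rightarrow> (nat \<Rightarrow> bool) \<Rightarrow> (nat \<Rightarrow> real)
       \<Rightarrow> (nat \<Rightarrow> int ^ 'd) \<Rightarrow> enat" where
  "settle_time h0 A x y h \<gamma> =
     Inf {enat t | t. \<exists>j k. hit (Sigma_set h0 j) \<gamma> = enat k
                         \<and> flash_time_at h0 j (x j) (y j) (h j) \<gamma> = enat t
                         \<and> \<gamma> t \<in> cell h0 j (\<gamma> k) \<inter> - A}"

text \<open>Explorers are numbered from \<open>0\<close>, so the cluster of \<open>Suc i\<close> explorers adds explorer \<open>i\<close>.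
  An explorer that never settles (an event of probability zero) leaves the cluster unchanged.\<close>

primrec cluster ::
    "real \<Rightarrow> (nat \<Rightarrow> nat \<Rightarrow> int ^ 'd) \<Rightarrow> (nat \<Rightarrow> nat \<Rightarrow> bool) \<Rightarrow> (nat \<Rightarrow> nat \<Rightarrow> bool)
       \<Rightarrow> (nat \<Rightarrow> nat \<Rightarrow> real) \<Rightarrow> nat \<Rightarrow> (int ^ 'd) set" where
  "cluster h0 S x y h 0 = {}"
| "cluster h0 S x y h (Suc i) =
     (let A = cluster h0 S x y h i in
      case settle_time h0 A (x i) (y i) (h i) (S i) of
        enat t \<Rightarrow> A \<union> {S i t}
      | \<infinity> \<Rightarrow> A)"

text \<open>\<open>inner_error h0 S X Y R n \<omega>\<close> is \<open>\<delta>\<^sup>*\<^sub>I(n)\<close> for the realization \<open>\<omega>\<close> of the random variables.\<close>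

definition inner_error ::
    "real \<Rightarrow> (nat \<Rightarrow> nat \<Rightarrow> 'a \<Rightarrow> int ^ 'd) \<Rightarrow> (nat \<Rightarrow> nat \<Rightarrow> 'a \<Rightarrow> bool) \<Rightarrow> (nat \<Rightarrow> nat \<Rightarrow> 'a \<Rightarrow> bool)
       \<Rightarrow> (nat \<Rightarrow> nat \<Rightarrow> 'a \<Rightarrow> real) \<Rightarrow> nat \<Rightarrow> 'a \<Rightarrow> real" where
  "inner_error h0 S X Y R n \<omega> =
     real n - Sup {r. r \<ge> 0 \<and>
       zball 0 r \<subseteq> cluster h0 (\<lambda>i t. S i t \<omega>) (\<lambda>i j. X i j \<omega>) (\<lambda>i j. Y i j \<omega>) (\<lambda>i j. R i j \<omega>)
                        (card (zball 0 (real n) :: (int ^ 'd) set))}"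


section \<open>Random variables driving the process\<close>

datatype source = Step nat nat | FlagX nat nat | FlagY nat nat | Radius nat nat

text \<open>The first index of each variable is the explorer. Independence is stated as in
  \<open>indep_vars\<close>, whose variables must all have the same range type.\<close>

locale flashing_variables = prob_space M for M :: "'a measure" +
  fixes h0 :: real
    and S :: "nat \<Rightarrow> nat \<Rightarrow> 'a \<Rightarrow> int ^ 'd"
    and X Y :: "nat \<Rightarrow> nat \<Rightarrow> 'a \<Rightarrow> bool"
    and R :: "nat \<Rightarrow> nat \<Rightarrow> 'a \<Rightarrow> real"
  assumes rv_S: "\<And>i t. random_variable (count_space UNIV) (S i t)"
    and rv_X: "\<And>i j. random_variable (count_space UNIV) (X i j)"
    and rv_Y: "\<And>i j. random_variable (count_space UNIV) (Y i j)"
    and walk_start: "\<And>i. AE \<omega> in M. S i 0 \<omega> = 0"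
    and walk_step: "\<And>i t. distr M (count_space UNIV) (\<lambda>\<omega>. S i (Suc t) \<omega> - S i t \<omega>)
                       = measure_pmf (pmf_of_set {e. nbr 0 e})"
    and law_X: "\<And>i j. distr M (count_space UNIV) (X i j)
                   = measure_pmf (bernoulli_pmf (1 / shell_h CARD('d) h0 j ^ CARD('d)))"
    and law_Y: "\<And>i j. distr M (count_space UNIV) (Y i j)
                   = measure_pmf (bernoulli_pmf (if j = 0 then 1 else 1 / 2))"
    and law_R: "\<And>i j. distributed M lborel (R i j)
                   (\<lambda>h. ennreal (real CARD('d) * h ^ (CARD('d) - 1) / shell_h CARD('d) h0 j ^ CARD('d)
                                 * indicator {0..shell_h CARD('d) h0 j} h))"
    and independent: "indep_sets
          (\<lambda>s. case s of
             Step i t \<Rightarrow> {(\<lambda>\<omega>. S i (Suc t) \<omega> - S i t \<omega>) -` B \<inter> space M | B. B \<in> sets (count_space UNIV)}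
           | FlagX i j \<Rightarrow> {X i j -` B \<inter> space M | B. B \<in> sets (count_space UNIV)}
           | FlagY i j \<Rightarrow> {Y i j -` B \<inter> space M | B. B \<in> sets (count_space UNIV)}
           | Radius i j \<Rightarrow> {R i j -` B \<inter> space M | B. B \<in> sets borel})
          UNIV"

end

theory Submission
  imports Defs
begin

text \<open>Write \<open>d\<close> for the dimension and \<open>L = n powr (1 / (d + 1))\<close>, which is the order of the width of the
shells at distance about \<open>n\<close>. The claim follows, by the Borel--Cantelli lemma, once for every
natural number \<open>A\<close> the probability that the cluster of \<open>card (zball 0 n)\<close> explorers contains
\<open>zball 0 (n - A * L)\<close> is shown to be \<open>O(1 / n\<^sup>2)\<close>.

Fix \<open>A\<close> and choose \<open>J\<close> so that the shell \<open>T\<close> with index \<open>Suc J\<close> lies inside \<open>zball 0 (n - A * L)\<close> and the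
ball \<open>B\<close> that it surrounds has radius at least \<open>n - (A + 6) * L\<close> (\<open>shell_below_radius\<close>). Suppose that
the cluster covers \<open>B\<close> and \<open>T\<close>. As every explorer settles at most one site, at least \<open>card B\<close>
explorers settle inside \<open>B\<close>. The others, called idle here, number at most
\<open>card (zball 0 n) - card B\<close>, and this is at most a constant multiple of \<open>card T\<close>, because an annulus of
width \<open>(A + 6) * L\<close> is compared with one of width at least \<open>L\<close> at the same distance
(\<open>shell_count_ratio\<close>). Each idle explorer flashes in \<open>T\<close> at most once, and only such flashes can
settle sites of \<open>T\<close>. So boundedly many balls per box are thrown into \<open>card T\<close> boxes, and every box
must be hit.

What remains is to see that these throws are sufficiently random. An explorer passes through the shells
in order and flashes in each of them before it reaches the next one, so the set of idle explorers is
decided by flashes inside \<open>B\<close> (\<open>cluster_inner_cong\<close>). It is therefore independent of the flags \<open>X\<close> and the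
radii \<open>R\<close> that belong to \<open>T\<close>. When all other variables are frozen (\<open>prob_diagonal_le\<close>), the flash sites of
different explorers in \<open>T\<close> are independent, and none of them charges a site with more than
probability \<open>1/2\<close>: since the walk makes unit steps, the flash site determines the radius up to a bounded
number of intervals of length one (\<open>flash_radius_near_landing\<close>), and the density of the radius is
at most \<open>d\<close> divided by half the width of the shell. A second moment computation
(\<open>prob_all_occupied_le\<close>) shows that \<open>K\<close> independent throws of this kind occupy all of \<open>M\<close> boxes with
probability at most \<open>exp (2 * K / M) / M\<close>. Here \<open>K / M\<close> is bounded and \<open>M\<close> is at least of order
\<open>n ^ (d - 1)\<close>, hence at least of order \<open>n\<^sup>2\<close> as \<open>d \<ge> 3\<close>.\<close>

section \<open>Counting lattice points\<close>

lemma finite_zball: "finite (zball x r :: (int ^ 'd) set)"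
proof -
  define m where "m = \<lceil>norm x + \<bar>r\<bar>\<rceil>"
  have "\<bar>z $ i\<bar> \<le> m" if "z \<in> zball x r" for z :: "int ^ 'd" and i
  proof -
    have "norm (rpt z) \<le> norm x + norm (rpt z - x)"
      using norm_triangle_ineq[of x "rpt z - x"] by simp
    also have "\<dots> \<le> norm x + \<bar>r\<bar>"
      using that by (auto simp: zball_def dist_norm norm_minus_commute)
    finally have "\<bar>rpt z $ i\<bar> \<le> norm x + \<bar>r\<bar>"
      using component_le_norm_cart[of "rpt z" i] by linarith
    then have "\<bar>real_of_int (z $ i)\<bar> \<le> norm x + \<bar>r\<bar>" by (simp add: rpt_def)
    then have "\<bar>real_of_int (z $ i)\<bar> \<le> of_int m"
      unfolding m_def using le_of_int_ceiling[of "norm x + \<bar>r\<bar>"] by linarith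
    then show ?thesis by linarith
  qed
  then have "zball x r \<subseteq> vec_lambda ` (UNIV \<rightarrow>\<^sub>E {-m..m})"
  proof (intro subsetI image_eqI)
    fix z :: "int ^ 'd" assume "z \<in> zball x r"
    then show "vec_nth z \<in> UNIV \<rightarrow>\<^sub>E {-m..m}"
      using \<open>\<And>z i. z \<in> zball x r \<Longrightarrow> \<bar>z $ i\<bar> \<le> m\<close> by (force simp: PiE_def abs_le_iff)
  qed simp
  moreover have "finite (vec_lambda ` (UNIV \<rightarrow>\<^sub>E {-m..m}) :: (int ^ 'd) set)"
    by (intro finite_imageI finite_PiE) auto
  ultimately show ?thesis by (rule finite_subset)
qed

lemma annulus_eq_Diff: "annulus a b = zball 0 b - zball 0 a"
  by (auto simp: annulus_def zball_def)

lemma finite_annulus: "finite (annulus a b :: (int ^ 'd) set)"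
  by (simp add: annulus_eq_Diff finite_zball)

lemma card_annulus:
  assumes "a \<le> b"
  shows "card (annulus a b :: (int ^ 'd) set) + card (zball 0 a :: (int ^ 'd) set)
           = card (zball 0 b :: (int ^ 'd) set)"
proof -
  have "(zball 0 a :: (int ^ 'd) set) \<subseteq> zball 0 b" using assms by (auto simp: zball_def)
  then show ?thesis
    by (simp add: annulus_eq_Diff card_Diff_subset finite_zball card_mono)
qed

definition unit_cube :: "int ^ 'd \<Rightarrow> (real ^ 'd) set" where
  "unit_cube z = {x. \<forall>i. \<lfloor>x $ i\<rfloor> = z $ i}"

lemma unit_cube_sandwich:
  "box (rpt z) (rpt z + 1) \<subseteq> unit_cube z" "unit_cube z \<subseteq> cbox (rpt z) (rpt z + 1)"
  by (auto simp: unit_cube_def rpt_def mem_box_cart floor_eq_iff less_eq_real_def)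

lemma sets_unit_cube [measurable]: "unit_cube z \<in> sets borel"
proof -
  have "unit_cube z = (\<Inter>i. {x. \<lfloor>x $ i\<rfloor> = z $ i})"
    by (auto simp: unit_cube_def)
  moreover have "{x :: real ^ 'a. \<lfloor>x $ i\<rfloor> = z $ i} \<in> sets borel" for i
    by measurable
  ultimately show ?thesis by auto
qed

lemma emeasure_unit_cube: "emeasure lborel (unit_cube (z :: int ^ 'd)) = 1"
proof -
  have le: "rpt z \<bullet> b \<le> (rpt z + 1) \<bullet> b" and one: "(rpt z + 1 - rpt z) \<bullet> b = 1" if "b \<in> Basis" for b
    using that by (auto simp: Basis_vec_def inner_axis inner_add_left)
  have "emeasure lborel (box (rpt z) (rpt z + 1)) = 1"
    using le one by (subst emeasure_lborel_box) (auto intro!: prod.neutral)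
  moreover have "emeasure lborel (cbox (rpt z) (rpt z + 1)) = 1"
    using le one by (subst emeasure_lborel_cbox) (auto intro!: prod.neutral)
  ultimately show ?thesis
    using emeasure_mono[OF unit_cube_sandwich(1)[of z], of lborel]
      emeasure_mono[OF unit_cube_sandwich(2)[of z], of lborel] by auto
qed

lemma dist_unit_cube: 
  assumes "x \<in> unit_cube (z :: int ^ 'd)" shows "norm (x - rpt z) \<le> CARD('d)"
proof -
  have "\<bar>(x - rpt z) $ i\<bar> \<le> 1" for i
    using subsetD[OF unit_cube_sandwich(2) assms] by (auto simp: mem_box_cart abs_le_iff algebra_simps)
  then have "(\<Sum>i\<in>UNIV. \<bar>(x - rpt z) $ i\<bar>) \<le> of_nat CARD('d) * 1"
    by (intro sum_bounded_above) auto
  then show ?thesis using norm_le_l1_cart[of "x - rpt z"] by simp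
qed

text \<open>The half-open unit cubes tile the space, so lattice points can be counted by volume. Each cube stays
within distance \<open>CARD('d)\<close> of its lattice point, which costs only that much in the radii below.\<close>

lemma card_eq_measure_cubes:
  assumes "finite Z"
  shows "real (card Z) = measure lborel (\<Union>z\<in>Z. unit_cube (z :: int ^ 'd))"
proof -
  have "disjoint_family_on unit_cube Z"
    unfolding disjoint_family_on_def
  proof (intro ballI impI)
    fix z z' :: "int ^ 'd" assume "z \<noteq> z'"
    then obtain i where "z $ i \<noteq> z' $ i" by (auto simp: vec_eq_iff)
    then show "unit_cube z \<inter> unit_cube z' = {}" by (fastforce simp: unit_cube_def)
  qed
  then have "measure lborel (\<Union>z\<in>Z. unit_cube z) = (\<Sum>z\<in>Z. measure lborel (unit_cube z))"
    using assms by (intro measure_finite_Union) (auto simp: emeasure_unit_cube)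
  then show ?thesis by (simp add: measure_def emeasure_unit_cube)
qed

lemma content_shell:
  assumes "0 \<le> a" "a \<le> b"
  shows "measure lborel (ball 0 b - ball (0 :: real ^ 'd) a)
           = unit_ball_vol CARD('d) * (b ^ CARD('d) - a ^ CARD('d))"
proof -
  have "measure lborel (ball 0 b - ball (0 :: real ^ 'd) a)
      = measure lborel (ball (0 :: real ^ 'd) b) - measure lborel (ball (0 :: real ^ 'd) a)"
    using assms emeasure_lborel_ball_finite[of "0 :: real ^ 'd" b]
    by (intro measure_Diff) (auto simp: top.not_eq_extremum)
  then show ?thesis using assms by (simp add: content_ball algebra_simps)
qed

text \<open>After \<open>b - a\<close> is factored out, a sum of \<open>Suc m\<close> terms is left, all of them at most \<open>b ^ m\<close> and
one of them equal to \<open>b ^ m\<close>.\<close>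

lemma power_diff_bounds:
  fixes a b :: real
  assumes "0 \<le> a" "a \<le> b"
  shows "b ^ Suc m - a ^ Suc m \<le> real (Suc m) * (b - a) * b ^ m"
    and "(b - a) * b ^ m \<le> b ^ Suc m - a ^ Suc m"
proof -
  have eq: "b ^ Suc m - a ^ Suc m = (b - a) * (\<Sum>i<Suc m. a ^ (m - i) * b ^ i)"
    using power_diff_sumr2[of b "Suc m" a] by simp
  have "a ^ (m - i) * b ^ i \<le> b ^ m" if "i < Suc m" for i
  proof -
    have "a ^ (m - i) * b ^ i \<le> b ^ (m - i) * b ^ i"
      using assms by (intro mult_right_mono power_mono) auto
    then show ?thesis using that by (simp flip: power_add)
  qed
  then have "(\<Sum>i<Suc m. a ^ (m - i) * b ^ i) \<le> of_nat (card {..<Suc m}) * b ^ m"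
    by (intro sum_bounded_above) auto
  from mult_left_mono[OF this, of "b - a"] show "b ^ Suc m - a ^ Suc m \<le> real (Suc m) * (b - a) * b ^ m"
    using assms unfolding eq by (simp add: mult_ac)
  have "b ^ m \<le> (\<Sum>i<Suc m. a ^ (m - i) * b ^ i)"
    using member_le_sum[of m "{..<Suc m}" "\<lambda>i. a ^ (m - i) * b ^ i"] assms by simp
  from mult_left_mono[OF this, of "b - a"] show "(b - a) * b ^ m \<le> b ^ Suc m - a ^ Suc m"
    using assms unfolding eq by simp
qed

text \<open>The cubes of the points of the annulus are contained in the annulus thickened by \<open>d\<close> on both sides.\<close>

lemma card_annulus_upper:
  fixes a b :: real
  defines "d \<equiv> real CARD('d)"
  assumes "d \<le> a" "a \<le> b"
  shows "real (card (annulus a b :: (int ^ 'd) set))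
           \<le> unit_ball_vol d * (d * (b - a + 2 * d) * (b + d) ^ (CARD('d) - 1))"
proof -
  have d: "d \<ge> 0" unfolding d_def by simp
  have "(\<Union>z\<in>annulus a b. unit_cube (z :: int ^ 'd)) \<subseteq> ball 0 (b + d) - ball 0 (a - d)"
  proof
    fix x assume "x \<in> (\<Union>z\<in>annulus a b. unit_cube (z :: int ^ 'd))"
    then obtain z :: "int ^ 'd" where z: "z \<in> annulus a b" "norm (x - rpt z) \<le> d"
      using dist_unit_cube unfolding d_def by blast
    then show "x \<in> ball 0 (b + d) - ball 0 (a - d)"
      using norm_triangle_sub[of x "rpt z"] norm_triangle_sub[of "rpt z" x]
      by (auto simp: annulus_def norm_minus_commute)
  qed
  then have "measure lborel (\<Union>z\<in>annulus a b. unit_cube (z :: int ^ 'd))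
      \<le> measure lborel (ball 0 (b + d) - ball (0 :: real ^ 'd) (a - d))"
    by (intro measure_mono_fmeasurable)
      (auto intro!: finite_annulus fmeasurable_Diff fmeasurableI emeasure_lborel_ball_finite order.strict_trans1[OF emeasure_mono[OF Diff_subset]])
  also have "\<dots> = unit_ball_vol d * ((b + d) ^ CARD('d) - (a - d) ^ CARD('d))"
    unfolding d_def using assms by (intro content_shell) (auto simp: d_def)
  also have "\<dots> \<le> unit_ball_vol d * (d * (b - a + 2 * d) * (b + d) ^ (CARD('d) - 1))"
    using power_diff_bounds(1)[of "a - d" "b + d" "CARD('d) - 1"] assms d
    by (intro mult_left_mono) (auto simp: d_def algebra_simps)
  finally show ?thesis by (simp add: card_eq_measure_cubes finite_annulus)
qed

text \<open>The annulus thinned by \<open>d\<close> on both sides is contained in the cubes of the points of the annulus.\<close>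

lemma card_annulus_lower:
  fixes a b :: real
  defines "d \<equiv> real CARD('d)"
  assumes "0 \<le> a" "a + 2 * d \<le> b"
  shows "unit_ball_vol d * ((b - a - 2 * d) * (b - d) ^ (CARD('d) - 1))
           \<le> real (card (annulus a b :: (int ^ 'd) set))"
proof -
  have d: "d \<ge> 0" unfolding d_def by simp
  have "ball 0 (b - d) - ball 0 (a + d) \<subseteq> (\<Union>z\<in>annulus a b. unit_cube (z :: int ^ 'd))"
  proof
    fix x :: "real ^ 'd" assume x: "x \<in> ball 0 (b - d) - ball 0 (a + d)"
    define z :: "int ^ 'd" where "z = (\<chi> i. \<lfloor>x $ i\<rfloor>)"
    have "x \<in> unit_cube z" by (auto simp: z_def unit_cube_def)
    moreover have "z \<in> annulus a b"
      using dist_unit_cube[OF \<open>x \<in> unit_cube z\<close>] x norm_triangle_sub[of x "rpt z"] norm_triangle_sub[of "rpt z" x]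
      by (auto simp: annulus_def norm_minus_commute d_def)
    ultimately show "x \<in> (\<Union>z\<in>annulus a b. unit_cube z)" by blast
  qed
  then have le: "measure lborel (ball 0 (b - d) - ball (0 :: real ^ 'd) (a + d))
      \<le> measure lborel (\<Union>z\<in>annulus a b. unit_cube (z :: int ^ 'd))"
    by (intro measure_mono_fmeasurable fmeasurable.finite_UN)
      (auto intro!: finite_annulus fmeasurableI simp: emeasure_unit_cube)
  have "unit_ball_vol d * ((b - a - 2 * d) * (b - d) ^ (CARD('d) - 1))
      \<le> unit_ball_vol d * ((b - d) ^ CARD('d) - (a + d) ^ CARD('d))"
    using power_diff_bounds(2)[of "a + d" "b - d" "CARD('d) - 1"] assms d
    by (intro mult_left_mono) (auto simp: d_def algebra_simps)
  also have "\<dots> = measure lborel (ball 0 (b - d) - ball (0 :: real ^ 'd) (a + d))"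
    unfolding d_def using assms by (intro content_shell[symmetric]) (auto simp: d_def)
  finally show ?thesis using le by (simp add: card_eq_measure_cubes finite_annulus)
qed

section \<open>Independent throws rarely occupy every box\<close>

lemma one_minus_ge_exp:
  fixes p :: real
  assumes "0 \<le> p" "p \<le> 1 / 2"
  shows "exp (- 2 * p) \<le> 1 - p"
proof -
  have "p * p \<le> p * (1 / 2)" using assms by (intro mult_left_mono) auto
  then have "- 2 * p \<le> - p - 2 * p\<^sup>2" by (simp add: power2_eq_square)
  also have "\<dots> \<le> ln (1 - p)" using ln_one_minus_pos_lower_bound[of p] assms by simp
  finally have "exp (- 2 * p) \<le> exp (ln (1 - p))" by simp
  then show ?thesis using assms by simp
qed

text \<open>Second moment method for the number \<open>U\<close> of sites of \<open>T\<close> that no \<open>F i\<close> hits. For two different sites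
the events of being missed are negatively correlated, because \<open>1 - p - p' \<le> (1 - p) * (1 - p')\<close> holds
for each factor. So the variance of \<open>U\<close> is at most its mean \<open>m\<close>, and Chebyshev's inequality
bounds the probability of \<open>U = 0\<close> by \<open>1 / m\<close>.\<close>

lemma (in prob_space) prob_all_occupied_le:
  fixes F :: "'i \<Rightarrow> 'a \<Rightarrow> 'b"
  assumes "finite I" "finite T" "T \<noteq> {}"
    and indep: "indep_vars (\<lambda>_. count_space UNIV) F I"
    and atom: "\<And>i v. i \<in> I \<Longrightarrow> v \<in> T \<Longrightarrow> prob {\<omega> \<in> space M. F i \<omega> = v} \<le> 1 / 2"
  shows "prob {\<omega> \<in> space M. \<forall>v\<in>T. \<exists>i\<in>I. F i \<omega> = v} \<le> exp (2 * real (card I) / real (card T)) / real (card T)"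
proof -
  have rv: "random_variable (count_space UNIV) (F i)" if "i \<in> I" for i
    using indep that by (auto simp: indep_vars_def)
  have ev: "{\<omega> \<in> space M. F i \<omega> \<in> A} \<in> events" if "i \<in> I" for i A
    using measurable_sets[OF rv[OF that], of A] by (simp add: vimage_def Int_def conj_commute)
  define p where "p i v = prob {\<omega> \<in> space M. F i \<omega> = v}" for i v
  define free where "free A = {\<omega> \<in> space M. \<forall>i\<in>I. F i \<omega> \<notin> A}" for A
  have free_ev [measurable]: "free A \<in> events" for A
  proof -
    have "free A = space M - (\<Union>i\<in>I. {\<omega> \<in> space M. F i \<omega> \<in> A})" by (auto simp: free_def)
    moreover have "space M - (\<Union>i\<in>I. {\<omega> \<in> space M. F i \<omega> \<in> A}) \<in> events"
      using ev \<open>finite I\<close> by (intro sets.compl_sets sets.finite_UN) auto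
    ultimately show ?thesis by (simp only:)
  qed
  have prod: "prob (free A) = (\<Prod>i\<in>I. 1 - prob {\<omega> \<in> space M. F i \<omega> \<in> A})" for A
  proof (cases "I = {}")
    case True
    then show ?thesis by (simp add: free_def prob_space)
  next
    case False
    have "free A = (\<Inter>i\<in>I. F i -` (- A) \<inter> space M)" using False by (auto simp: free_def)
    also have "prob \<dots> = (\<Prod>i\<in>I. prob (F i -` (- A) \<inter> space M))"
      using indep False \<open>finite I\<close> by (intro indep_varsD_finite) auto
    also have "\<dots> = (\<Prod>i\<in>I. 1 - prob {\<omega> \<in> space M. F i \<omega> \<in> A})"
    proof (intro prod.cong refl)
      fix i assume "i \<in> I"
      have "F i -` (- A) \<inter> space M = space M - {\<omega> \<in> space M. F i \<omega> \<in> A}" by auto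
      then show "prob (F i -` (- A) \<inter> space M) = 1 - prob {\<omega> \<in> space M. F i \<omega> \<in> A}"
        using prob_compl[OF ev[OF \<open>i \<in> I\<close>]] by simp
    qed
    finally show ?thesis .
  qed
  define q where "q v = prob (free {v})" for v
  have q_prod: "q v = (\<Prod>i\<in>I. 1 - p i v)" for v by (simp add: q_def prod p_def)
  have q_pair: "prob (free {v} \<inter> free {w}) \<le> q v * q w" if "v \<noteq> w" "v \<in> T" "w \<in> T" for v w
  proof -
    have "prob (free {v} \<inter> free {w}) = prob (free {v, w})"
      by (rule arg_cong[of _ _ prob]) (auto simp: free_def)
    also have "\<dots> \<le> (\<Prod>i\<in>I. (1 - p i v) * (1 - p i w))"
      unfolding prod
    proof (intro prod_mono conjI)
      fix i assume i: "i \<in> I"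
      show "0 \<le> 1 - prob {\<omega> \<in> space M. F i \<omega> \<in> {v, w}}" by simp
      have "{\<omega> \<in> space M. F i \<omega> \<in> {v, w}} = {\<omega> \<in> space M. F i \<omega> = v} \<union> {\<omega> \<in> space M. F i \<omega> = w}"
        by auto
      then have "prob {\<omega> \<in> space M. F i \<omega> \<in> {v, w}} = p i v + p i w"
        using ev[OF i, of "{v}"] ev[OF i, of "{w}"] \<open>v \<noteq> w\<close> by (auto simp: p_def intro!: finite_measure_Union)
      then show "1 - prob {\<omega> \<in> space M. F i \<omega> \<in> {v, w}} \<le> (1 - p i v) * (1 - p i w)"
        by (simp add: algebra_simps p_def)
    qed
    also have "\<dots> = q v * q w" by (simp add: q_prod prod.distrib)
    finally show ?thesis .
  qed
  define m where "m = (\<Sum>v\<in>T. q v)"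
  define t where "t = 2 * real (card I) / real (card T)"
  have T: "real (card T) > 0" using assms by (simp add: card_gt_0_iff)
  \<comment> \<open>Jensen's inequality for \<open>exp\<close>: the exponents \<open>a v\<close> below average to at most \<open>t\<close>, and \<open>exp (- a)\<close> lies
above its tangent line at \<open>t\<close>.\<close>
  have m_ge: "real (card T) * exp (- t) \<le> m"
  proof -
    define a where "a v = 2 * (\<Sum>i\<in>I. p i v)" for v
    have "(\<Sum>v\<in>T. a v) = 2 * (\<Sum>i\<in>I. \<Sum>v\<in>T. p i v)"
      unfolding a_def sum_distrib_left[symmetric] by (subst sum.swap) simp
    also have "\<dots> \<le> 2 * (\<Sum>i\<in>I. 1)"
    proof (intro mult_left_mono sum_mono)
      fix i assume i: "i \<in> I"
      have "(\<Sum>v\<in>T. p i v) = prob (\<Union>v\<in>T. {\<omega> \<in> space M. F i \<omega> = v})"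
        unfolding p_def using \<open>finite T\<close> ev[OF i, of "{_}"]
        by (intro finite_measure_finite_Union[symmetric]) (auto simp: disjoint_family_on_def)
      then show "(\<Sum>v\<in>T. p i v) \<le> 1" by simp
    qed simp
    finally have a_sum: "(\<Sum>v\<in>T. a v) \<le> real (card T) * t" using T by (simp add: t_def)
    have q_ge: "exp (- t) * (1 + t - a v) \<le> q v" if "v \<in> T" for v
    proof -
      have "1 + t - a v \<le> exp (t - a v)"
        using exp_ge_add_one_self[of "t - a v"] by linarith
      then have "exp (- t) * (1 + t - a v) \<le> exp (- t) * exp (t - a v)"
        by (intro mult_left_mono) auto
      also have "\<dots> = exp (- a v)" by (simp flip: exp_add)
      also have "\<dots> = (\<Prod>i\<in>I. exp (- 2 * p i v))"
        using \<open>finite I\<close> by (simp add: a_def sum_distrib_left sum_negf exp_sum flip: exp_sum)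
      also have "\<dots> \<le> q v"
        unfolding q_prod using atom[OF _ that]
        by (intro prod_mono conjI one_minus_ge_exp) (auto simp: p_def)
      finally show ?thesis .
    qed
    have "real (card T) * exp (- t) \<le> exp (- t) * (real (card T) + (real (card T) * t - (\<Sum>v\<in>T. a v)))"
      using a_sum by simp
    also have "\<dots> = (\<Sum>v\<in>T. exp (- t) * (1 + t - a v))"
      by (simp add: sum.distrib sum_subtractf algebra_simps sum_distrib_right)
    also have "\<dots> \<le> m" unfolding m_def by (intro sum_mono q_ge)
    finally show ?thesis .
  qed
  moreover have "0 < real (card T) * exp (- t)" using T by simp
  ultimately have m_pos: "m > 0" by linarith
  define U :: "'a \<Rightarrow> real" where "U \<omega> = (\<Sum>v\<in>T. indicator (free {v}) \<omega>)" for \<omega>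
  have U_rv [measurable]: "U \<in> borel_measurable M" unfolding U_def by measurable
  have ind: "integrable M (indicat_real (free A \<inter> free B))" for A B
    by (intro integrable_real_indicator) (auto simp: emeasure_eq_measure)
  have ind1: "integrable M (indicat_real (free A))" for A using ind[of A A] by simp
  have EU: "expectation U = m"
    unfolding U_def m_def q_def using ind1 by (subst Bochner_Integration.integral_sum) auto
  have U2: "U \<omega> ^ 2 = (\<Sum>v\<in>T. \<Sum>w\<in>T. indicator (free {v} \<inter> free {w}) \<omega>)" for \<omega>
    unfolding U_def power2_eq_square sum_product by (simp add: indicator_inter_arith)
  have int: "integrable M (\<lambda>\<omega>. U \<omega>)" "integrable M (\<lambda>\<omega>. U \<omega> ^ 2)"
    unfolding U2 unfolding U_def by (intro Bochner_Integration.integrable_sum ind ind1)+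
  have "expectation (\<lambda>\<omega>. U \<omega> ^ 2) = (\<Sum>v\<in>T. \<Sum>w\<in>T. prob (free {v} \<inter> free {w}))"
    unfolding U2 by (simp add: Bochner_Integration.integral_sum ind)
  also have "\<dots> \<le> (\<Sum>v\<in>T. \<Sum>w\<in>T. q v * q w + (if v = w then q v else 0))"
    using q_pair by (intro sum_mono) (auto simp: q_def)
  also have "\<dots> = m ^ 2 + m"
    using \<open>finite T\<close> by (simp add: sum.distrib m_def power2_eq_square sum_product)
  finally have EU2: "expectation (\<lambda>\<omega>. U \<omega> ^ 2) \<le> m ^ 2 + m" .
  let ?C = "{\<omega> \<in> space M. \<forall>v\<in>T. \<exists>i\<in>I. F i \<omega> = v}"
  have "?C = space M - (\<Union>v\<in>T. free {v})" by (auto simp: free_def)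
  moreover have "space M - (\<Union>v\<in>T. free {v}) \<in> events"
    using \<open>finite T\<close> by (intro sets.compl_sets sets.finite_UN) auto
  ultimately have C [measurable]: "?C \<in> events" by (simp only:)
  \<comment> \<open>Chebyshev's inequality: on the event \<open>?C\<close> the variable \<open>(1 - U / m)\<^sup>2\<close> equals \<open>1\<close>.\<close>
  have "prob ?C = expectation (indicator ?C)" by simp
  also have "\<dots> \<le> expectation (\<lambda>\<omega>. 1 - 2 / m * U \<omega> + U \<omega> ^ 2 / m ^ 2)"
  proof (intro integral_mono)
    fix \<omega> assume "\<omega> \<in> space M"
    have "U \<omega> = 0" if "\<omega> \<in> ?C" using that unfolding U_def free_def by (intro sum.neutral) auto
    moreover have "1 - 2 / m * U \<omega> + U \<omega> ^ 2 / m ^ 2 = (1 - U \<omega> / m) ^ 2"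
      by (simp add: power2_eq_square algebra_simps add_divide_distrib)
    ultimately show "indicator ?C \<omega> \<le> 1 - 2 / m * U \<omega> + U \<omega> ^ 2 / m ^ 2"
      by (auto simp: indicator_def)
  next
    show "integrable M (indicat_real ?C)"
      by (intro integrable_real_indicator C) (auto simp: emeasure_eq_measure)
    show "integrable M (\<lambda>\<omega>. 1 - 2 / m * U \<omega> + U \<omega> ^ 2 / m ^ 2)" using int by simp
  qed
  also have "\<dots> = 1 - 2 / m * m + expectation (\<lambda>\<omega>. U \<omega> ^ 2) / m ^ 2"
    using int by (simp add: EU prob_space)
  also have "\<dots> \<le> 1 - 2 / m * m + (m ^ 2 + m) / m ^ 2"
    using EU2 by (intro add_left_mono divide_right_mono) auto
  also have "\<dots> = 1 / m" using m_pos by (simp add: field_simps power2_eq_square)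
  also have "\<dots> \<le> 1 / (real (card T) * exp (- t))"
    using m_ge T m_pos by (intro divide_left_mono mult_pos_pos) auto
  also have "\<dots> = exp t / real (card T)" by (simp add: exp_minus field_simps)
  finally show ?thesis unfolding t_def .
qed

section \<open>Shells and flashes\<close>

text \<open>Consecutive shells touch, so this is also the inner radius of the shell with index \<open>Suc j\<close>, and the ball
of this radius is the union of the shells up to index \<open>j\<close>.\<close>

definition shell_outer :: "nat \<Rightarrow> real \<Rightarrow> nat \<Rightarrow> real" where
  "shell_outer d h0 j = shell_r d h0 j + shell_h d h0 j"

context
  fixes h0 :: real and d :: nat
  assumes h0: "h0 \<ge> 1" and d: "d \<ge> 1"
begin

lemma shell_h_ge_1: "shell_h d h0 j \<ge> 1"
proof (cases j)
  case 0
  then show ?thesis using h0 d by (simp add: shell_recursion)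
next
  case (Suc k)
  have "1 powr (1 / (real d + 1)) \<le> shell_r d h0 (Suc k) powr (1 / (real d + 1))"
    using shell_recursion(3)[OF h0 d, of k] by (intro powr_mono2) auto
  then show ?thesis using Suc shell_recursion(4)[OF h0 d, of k] by simp
qed

lemma shell_r_Suc: "shell_r d h0 (Suc j) = shell_outer d h0 j + shell_h d h0 (Suc j)"
  using shell_recursion(5)[OF h0 d, of j] by (simp add: shell_outer_def)

lemma shell_outer_0: "shell_outer d h0 0 = h0"
  using shell_recursion(1,2)[OF h0 d] by (simp add: shell_outer_def)

lemma shell_outer_Suc: "shell_outer d h0 (Suc j) = shell_outer d h0 j + 2 * shell_h d h0 (Suc j)"
  using shell_r_Suc[of j] by (simp add: shell_outer_def)

lemma shell_outer_mono: "i \<le> j \<Longrightarrow> shell_outer d h0 i \<le> shell_outer d h0 j"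
proof (induction j rule: dec_induct)
  case (step n)
  then show ?case using shell_outer_Suc[of n] shell_h_ge_1[of "Suc n"] by linarith
qed simp

lemma shell_outer_pos: "shell_outer d h0 j \<ge> 1"
  using shell_outer_mono[of 0 j] shell_outer_0 h0 by simp

end

lemma zball_mono: "r \<le> r' \<Longrightarrow> zball x r \<subseteq> zball x r'"
  by (auto simp: zball_def)

lemma zball_0_iff: "z \<in> zball 0 r \<longleftrightarrow> norm (rpt z) < r"
  by (simp add: zball_def)

lemma annulus_iff: "z \<in> annulus a b \<longleftrightarrow> a \<le> norm (rpt z) \<and> norm (rpt z) < b"
  by (auto simp: annulus_def)

lemma shell_Suc:
  assumes "h0 \<ge> 1"
  shows "(shell h0 (Suc j) :: (int ^ 'd) set)
           = annulus (shell_outer CARD('d) h0 j) (shell_outer CARD('d) h0 (Suc j))"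
  using shell_r_Suc[OF assms, of "CARD('d)" j] by (simp add: shell_def shell_outer_def Suc_le_eq)

lemma shell_subset_zball:
  assumes "h0 \<ge> 1"
  shows "(shell h0 j :: (int ^ 'd) set) \<subseteq> zball 0 (shell_outer CARD('d) h0 j)"
proof (cases j)
  case 0
  then show ?thesis using shell_outer_0[OF assms, of "CARD('d)"] by (simp add: shell_def Suc_le_eq)
next
  case (Suc k)
  then show ?thesis by (auto simp: shell_Suc[OF assms] annulus_iff zball_0_iff)
qed

lemma shell_Int_zball:
  assumes "h0 \<ge> 1" "i < j"
  shows "(shell h0 j :: (int ^ 'd) set) \<inter> zball 0 (shell_outer CARD('d) h0 i) = {}"
proof -
  obtain k where k: "j = Suc k" "i \<le> k" using assms(2) by (cases j) auto
  then have "shell_outer CARD('d) h0 i \<le> shell_outer CARD('d) h0 k"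
    using shell_outer_mono[OF assms(1)] by (simp add: Suc_le_eq)
  then show ?thesis using k by (auto simp: shell_Suc[OF assms(1)] annulus_iff zball_0_iff)
qed

lemma shells_disjoint:
  assumes "h0 \<ge> 1" "v \<in> (shell h0 i :: (int ^ 'd) set)" "v \<in> shell h0 j"
  shows "i = j"
  using shell_Int_zball[OF assms(1), of i j] shell_Int_zball[OF assms(1), of j i]
    shell_subset_zball[OF assms(1), of i] shell_subset_zball[OF assms(1), of j] assms(2,3)
  by (metis disjoint_iff linorder_neqE_nat subsetD)

definition first_visit :: "'s set \<Rightarrow> (nat \<Rightarrow> 's) \<Rightarrow> nat \<Rightarrow> bool" where
  "first_visit L \<gamma> t \<longleftrightarrow> \<gamma> t \<in> L \<and> (\<forall>s<t. \<gamma> s \<notin> L)"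

lemma Inf_enat_Least: "P s \<Longrightarrow> Inf {enat t | t. P t} = enat (LEAST t. P t)"
  by (rule antisym[OF Inf_lower Inf_greatest]) (auto intro: LeastI Least_le)

lemma Inf_eq_enat_iff: "Inf {enat t | t. P t} = enat t \<longleftrightarrow> P t \<and> (\<forall>s<t. \<not> P s)"
proof
  assume *: "Inf {enat t | t. P t} = enat t"
  then have "{enat t | t. P t} \<noteq> {}" by (metis Inf_empty enat.distinct(1) top_enat_def)
  then obtain s where s: "P s" by auto
  then have "t = (LEAST t. P t)" using * by (simp add: Inf_enat_Least)
  then show "P t \<and> (\<forall>s<t. \<not> P s)" using s by (metis LeastI not_less_Least)
next
  assume *: "P t \<and> (\<forall>s<t. \<not> P s)"
  then have "(LEAST t. P t) = t" by (intro Least_equality) (auto simp: not_less[symmetric])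
  then show "Inf {enat t | t. P t} = enat t" using * Inf_enat_Least[of P t] by simp
qed

lemma hit_eq_enat_iff: "hit L \<gamma> = enat t \<longleftrightarrow> first_visit L \<gamma> t"
proof -
  have "hit L \<gamma> = Inf {enat t | t. \<gamma> t \<in> L}"
    unfolding hit_def by (rule arg_cong[of _ _ Inf]) auto
  then show ?thesis by (simp only: Inf_eq_enat_iff first_visit_def)
qed

text \<open>The set whose exit makes an explorer with flag \<open>X = 0\<close> flash, when it met \<open>\<Sigma>\<^sub>j\<close> at \<open>z\<close>.\<close>

definition flash_domain :: "real \<Rightarrow> nat \<Rightarrow> bool \<Rightarrow> real \<Rightarrow> int ^ 'd \<Rightarrow> (int ^ 'd) set" where
  "flash_domain h0 j y h z =
     (if y then zball (rpt z) (min h (shell_outer CARD('d) h0 j - norm (rpt z)))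
      else annulus (shell_r CARD('d) h0 j - h) (shell_r CARD('d) h0 j + h))"

text \<open>The explorer flashes at time \<open>t\<close> in its own cell of shell \<open>j\<close>. This form mentions no extended times: it is a
countable combination of conditions on single positions, from which measurability can be read off.\<close>

definition lands ::
    "real \<Rightarrow> nat \<Rightarrow> bool \<Rightarrow> bool \<Rightarrow> real \<Rightarrow> (nat \<Rightarrow> int ^ 'd) \<Rightarrow> nat \<Rightarrow> bool" where
  "lands h0 j x y h \<gamma> t \<longleftrightarrow>
     (\<exists>k\<le>t. first_visit (Sigma_set h0 j) \<gamma> k \<and> \<gamma> t \<in> cell h0 j (\<gamma> k) \<and>
        (if x then t = k
         else \<gamma> t \<notin> flash_domain h0 j y h (\<gamma> k) \<and>
              (\<forall>s\<in>{k..<t}. \<gamma> s \<in> flash_domain h0 j y h (\<gamma> k))))"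

lemma flash_time_eq_enat_iff:
  "flash_time h0 j x y h \<gamma> = enat u \<longleftrightarrow>
     (if x then u = 0 else first_visit (- flash_domain h0 j y h (\<gamma> 0)) \<gamma> u)"
  by (simp add: flash_time_def flash_domain_def shell_outer_def Let_def hit_eq_enat_iff)
    (auto simp: zero_enat_def)

lemma enat_add_eq_enat_iff: "enat k + e = enat t \<longleftrightarrow> (\<exists>u. e = enat u \<and> t = k + u)"
  by (cases e) auto

lemma lands_iff:
  "lands h0 j x y h \<gamma> t \<longleftrightarrow>
     (\<exists>k. hit (Sigma_set h0 j) \<gamma> = enat k \<and> flash_time_at h0 j x y h \<gamma> = enat t
        \<and> \<gamma> t \<in> cell h0 j (\<gamma> k))" (is "_ \<longleftrightarrow> (\<exists>k. ?H k)")
proof -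
  have shift: "(\<forall>s<u. \<gamma> (k + s) \<in> D) \<longleftrightarrow> (\<forall>s\<in>{k..<k + u}. \<gamma> s \<in> D)" for k u D
    by (auto simp: le_iff_add)
  have "?H k \<longleftrightarrow> k \<le> t \<and> first_visit (Sigma_set h0 j) \<gamma> k \<and> \<gamma> t \<in> cell h0 j (\<gamma> k) \<and>
      (if x then t = k
       else \<gamma> t \<notin> flash_domain h0 j y h (\<gamma> k) \<and>
            (\<forall>s\<in>{k..<t}. \<gamma> s \<in> flash_domain h0 j y h (\<gamma> k)))" for k
  proof (cases "hit (Sigma_set h0 j) \<gamma> = enat k")
    case True
    then have "flash_time_at h0 j x y h \<gamma> = enat t \<longleftrightarrow> (\<exists>u. t = k + u \<and>
        (if x then u = 0
         else first_visit (- flash_domain h0 j y h (\<gamma> k)) (\<lambda>t. \<gamma> (k + t)) u))"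
      by (auto simp: flash_time_at_def enat_add_eq_enat_iff flash_time_eq_enat_iff)
    also have "\<dots> \<longleftrightarrow> k \<le> t \<and> (if x then t = k
       else \<gamma> t \<notin> flash_domain h0 j y h (\<gamma> k) \<and>
            (\<forall>s\<in>{k..<t}. \<gamma> s \<in> flash_domain h0 j y h (\<gamma> k)))"
      unfolding first_visit_def le_iff_add by (auto simp: shift)
    finally show ?thesis using True by (auto simp: hit_eq_enat_iff)
  next
    case False
    then show ?thesis by (auto simp: hit_eq_enat_iff)
  qed
  then show ?thesis unfolding lands_def by blast
qed

lemma settle_time_eq_Inf:
  "settle_time h0 A x y h \<gamma> = Inf {enat t | t. \<exists>j. lands h0 j (x j) (y j) (h j) \<gamma> t \<and> \<gamma> t \<notin> A}"
  unfolding settle_time_def lands_iff by (rule arg_cong[of _ _ Inf]) auto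

lemma settle_time_eq_enat_iff:
  "settle_time h0 A x y h \<gamma> = enat t \<longleftrightarrow>
     (\<exists>j. lands h0 j (x j) (y j) (h j) \<gamma> t \<and> \<gamma> t \<notin> A) \<and>
     (\<forall>s<t. \<not> (\<exists>j. lands h0 j (x j) (y j) (h j) \<gamma> s \<and> \<gamma> s \<notin> A))"
  unfolding settle_time_eq_Inf by (rule Inf_eq_enat_iff)

lemma cluster_Suc_iff:
  "v \<in> cluster h0 S x y h (Suc i) \<longleftrightarrow> v \<in> cluster h0 S x y h i \<or>
     (\<exists>t. settle_time h0 (cluster h0 S x y h i) (x i) (y i) (h i) (S i) = enat t \<and> v = S i t)"
  by (auto simp: Let_def split: enat.splits)

lemma lands_in_shell: "lands h0 j x y h \<gamma> t \<Longrightarrow> \<gamma> t \<in> shell h0 j"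
  by (auto simp: lands_def cell_def)

text \<open>As an explorer flashes at most once in each shell, its landing time there is unique if it exists.\<close>

definition landing_site ::
    "real \<Rightarrow> nat \<Rightarrow> bool \<Rightarrow> bool \<Rightarrow> real \<Rightarrow> (nat \<Rightarrow> int ^ 'd) \<Rightarrow> (int ^ 'd) option" where
  "landing_site h0 j x y h \<gamma> =
     (if \<exists>t. lands h0 j x y h \<gamma> t then Some (\<gamma> (THE t. lands h0 j x y h \<gamma> t)) else None)"

lemma landing_site_eq_Some_iff:
  "landing_site h0 j x y h \<gamma> = Some v \<longleftrightarrow> (\<exists>t. lands h0 j x y h \<gamma> t \<and> \<gamma> t = v)"
proof -
  have "(THE t. lands h0 j x y h \<gamma> t) = t" if "lands h0 j x y h \<gamma> t" for t
    using that unfolding lands_iff by (intro the_equality) auto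
  then show ?thesis unfolding landing_site_def by auto
qed

section \<open>Nearest-neighbour paths\<close>

definition nn_path :: "(nat \<Rightarrow> int ^ 'd) \<Rightarrow> bool" where
  "nn_path \<gamma> \<longleftrightarrow> \<gamma> 0 = 0 \<and> (\<forall>t. nbr (\<gamma> t) (\<gamma> (Suc t)))"

lemma rpt_0 [simp]: "rpt 0 = 0"
  by (simp add: rpt_def vec_eq_iff)

text \<open>A path with unit steps can leave a ball only through the outer boundary of the ball, so up to its first
visit to \<open>\<Sigma>\<^sub>j\<close> it is confined to the ball of radius \<open>r\<^sub>j\<close>.\<close>

lemma nn_path_first_visit_Sigma:
  fixes \<gamma> :: "nat \<Rightarrow> int ^ 'd"
  assumes "h0 \<ge> 1" "nn_path \<gamma>" "first_visit (Sigma_set h0 (Suc j)) \<gamma> k"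
  shows "s < k \<Longrightarrow> norm (rpt (\<gamma> s)) < shell_r CARD('d) h0 (Suc j)"
    and "shell_r CARD('d) h0 (Suc j) \<le> norm (rpt (\<gamma> k))"
    and "norm (rpt (\<gamma> k)) \<le> shell_r CARD('d) h0 (Suc j) + 1"
proof -
  have Sigma: "\<gamma> k \<in> outer_boundary (zball 0 (shell_r CARD('d) h0 (Suc j)))"
    and not_Sigma: "s < k \<Longrightarrow> \<gamma> s \<notin> outer_boundary (zball 0 (shell_r CARD('d) h0 (Suc j)))" for s
    using assms(3) by (auto simp: first_visit_def Sigma_set_def)
  show "norm (rpt (\<gamma> s)) < shell_r CARD('d) h0 (Suc j)" if "s < k" for s
    using that
  proof (induction s)
    case 0
    then show ?case
      using assms shell_recursion(3)[OF assms(1), of "CARD('d)" j] by (simp add: nn_path_def Suc_le_eq)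
  next
    case (Suc s)
    then show ?case
      using not_Sigma[of "Suc s"] assms(2) by (auto simp: outer_boundary_def zball_0_iff nn_path_def)
  qed
  show "shell_r CARD('d) h0 (Suc j) \<le> norm (rpt (\<gamma> k))"
    using Sigma by (auto simp: outer_boundary_def zball_0_iff)
  obtain z where z: "norm (rpt z) < shell_r CARD('d) h0 (Suc j)" "nbr z (\<gamma> k)"
    using Sigma by (auto simp: outer_boundary_def zball_0_iff)
  then show "norm (rpt (\<gamma> k)) \<le> shell_r CARD('d) h0 (Suc j) + 1"
    using norm_triangle_sub[of "rpt (\<gamma> k)" "rpt z"] by (simp add: nbr_def norm_minus_commute)
qed

lemma flash_domain_subset:
  fixes z :: "int ^ 'd"
  assumes "h \<le> shell_h CARD('d) h0 j"
  shows "flash_domain h0 j y h z \<subseteq> zball 0 (shell_outer CARD('d) h0 j)"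
proof
  fix u assume u: "u \<in> flash_domain h0 j y h z"
  show "u \<in> zball 0 (shell_outer CARD('d) h0 j)"
  proof (cases y)
    case True
    then have "norm (rpt u - rpt z) < shell_outer CARD('d) h0 j - norm (rpt z)"
      using u by (auto simp: flash_domain_def zball_def dist_norm norm_minus_commute)
    then show ?thesis using norm_triangle_sub[of "rpt u" "rpt z"] by (simp add: zball_0_iff)
  next
    case False
    then show ?thesis using u assms by (simp add: flash_domain_def annulus_iff zball_0_iff shell_outer_def)
  qed
qed

text \<open>Before \<open>\<Sigma>\<^sub>j\<close> is met the path is in the ball of radius \<open>r\<^sub>j\<close>, afterwards it is in the flash domain,
and the landing site itself is in shell \<open>j\<close>.\<close>

lemma path_until_landing:
  fixes \<gamma> :: "nat \<Rightarrow> int ^ 'd"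
  assumes "h0 \<ge> 1" "nn_path \<gamma>" "h \<le> shell_h CARD('d) h0 j" "lands h0 j x y h \<gamma> t" "s \<le> t"
  shows "norm (rpt (\<gamma> s)) < shell_outer CARD('d) h0 j"
proof -
  obtain k where k: "k \<le> t" "first_visit (Sigma_set h0 j) \<gamma> k"
    "\<And>s. \<not> x \<Longrightarrow> s \<in> {k..<t} \<Longrightarrow> \<gamma> s \<in> flash_domain h0 j y h (\<gamma> k)" "x \<Longrightarrow> t = k"
  proof -
    obtain k where "k \<le> t" "first_visit (Sigma_set h0 j) \<gamma> k"
      "if x then t = k
       else \<gamma> t \<notin> flash_domain h0 j y h (\<gamma> k) \<and>
            (\<forall>s\<in>{k..<t}. \<gamma> s \<in> flash_domain h0 j y h (\<gamma> k))"
      using assms(4) unfolding lands_def by blast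
    then show ?thesis by (intro that[of k]) (auto split: if_splits)
  qed
  consider "s = t" | "s < k" | "k \<le> s" "s < t" using assms(5) k(1) by linarith
  then show ?thesis
  proof cases
    case 1
    then show ?thesis
      using lands_in_shell[OF assms(4)] shell_subset_zball[OF assms(1), of j] by (auto simp: zball_0_iff)
  next
    case 2
    then obtain i where i: "j = Suc i"
      using k(2) assms(2) by (cases j) (auto simp: first_visit_def Sigma_set_def nn_path_def)
    have "shell_h CARD('d) h0 j \<ge> 1"
      by (rule shell_h_ge_1[OF assms(1)]) (simp add: Suc_le_eq)
    then show ?thesis
      using nn_path_first_visit_Sigma(1)[OF assms(1,2) k(2)[unfolded i] 2] i by (simp add: shell_outer_def)
  next
    case 3
    then have "\<gamma> s \<in> flash_domain h0 j y h (\<gamma> k)" using k(3)[of s] k(4) by auto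
    then show ?thesis using flash_domain_subset[OF assms(3)] zball_0_iff by blast
  qed
qed

text \<open>When the flash in shell \<open>j\<close> occurs, the path has not yet left the ball of radius \<open>r\<^sub>j + h\<^sub>j\<close>, whereas
the flash in shell \<open>j'\<close> comes after a visit to \<open>\<Sigma>\<close> outside that ball. So the flashes of one
explorer occur in the order of the shells, and a successful flash in an inner shell decides where it
settles.\<close>

lemma lands_order:
  fixes \<gamma> :: "nat \<Rightarrow> int ^ 'd"
  assumes "h0 \<ge> 1" "nn_path \<gamma>" "h \<le> shell_h CARD('d) h0 j"
    and "lands h0 j x y h \<gamma> t" "lands h0 j' x' y' h' \<gamma> t'" "j < j'"
  shows "t < t'"
proof (rule ccontr)
  assume "\<not> t < t'"
  obtain k where k: "k \<le> t'" "first_visit (Sigma_set h0 j') \<gamma> k"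
    using assms(5) unfolding lands_def by auto
  obtain i where i: "j' = Suc i" "j \<le> i" using assms(6) by (cases j') auto
  have "norm (rpt (\<gamma> k)) < shell_outer CARD('d) h0 j"
    using \<open>\<not> t < t'\<close> k(1) by (intro path_until_landing[OF assms(1-4)]) auto
  also have "\<dots> \<le> shell_outer CARD('d) h0 i"
    using i(2) by (intro shell_outer_mono[OF assms(1)]) (auto simp: Suc_le_eq)
  also have "\<dots> \<le> shell_r CARD('d) h0 j'"
    using shell_r_Suc[OF assms(1), of "CARD('d)" i] shell_h_ge_1[OF assms(1), of "CARD('d)" j']
    by (simp add: i Suc_le_eq)
  also have "\<dots> \<le> norm (rpt (\<gamma> k))"
    using nn_path_first_visit_Sigma(2)[OF assms(1,2)] k(2) by (simp add: i)
  finally show False by simp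
qed

text \<open>A path with unit steps passes the boundary of its flash domain by at most \<open>1\<close>, so the landing site pins
down the radius up to an interval of length one for each way of leaving the domain. Together with a
density bound this makes every single landing site improbable.\<close>

lemma flash_radius_near_landing:
  fixes \<gamma> :: "nat \<Rightarrow> int ^ 'd" and v :: "int ^ 'd"
  assumes "h0 \<ge> 1" "nn_path \<gamma>"
  obtains C where "finite C" "card C \<le> 5"
    "\<And>h t. lands h0 (Suc j) False y h \<gamma> t \<Longrightarrow> \<gamma> t = v \<Longrightarrow> 0 \<le> h \<Longrightarrow> h \<le> shell_h CARD('d) h0 (Suc j)
       \<Longrightarrow> \<exists>c\<in>C. h \<in> {c - 1..c}"
proof (cases "\<exists>k. first_visit (Sigma_set h0 (Suc j)) \<gamma> k")
  case False
  then show ?thesis by (intro that[of "{}"]) (auto simp: lands_def)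
next
  case True
  then obtain k where k: "first_visit (Sigma_set h0 (Suc j)) \<gamma> k" by blast
  define z where "z = rpt (\<gamma> k)"
  define r where "r = shell_r CARD('d) h0 (Suc j)"
  define w where "w = shell_h CARD('d) h0 (Suc j)"
  have z: "r \<le> norm z" "norm z \<le> r + 1"
    using nn_path_first_visit_Sigma(2,3)[OF assms k] by (auto simp: z_def r_def)
  \<comment> \<open>In this order: exit from a ball of radius \<open>h\<close>, exit from a ball cut off at the outer radius of the shell
(possible only if \<open>h\<close> is within \<open>1\<close> of \<open>w\<close>), a starting point already outside the annulus, and exit
through the outer or the inner boundary of the annulus.\<close>
  define C where "C = {norm (rpt v - z), w, 1, norm (rpt v) - r, r - norm (rpt v)}"
  have "\<exists>c\<in>C. h \<in> {c - 1..c}"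
    if lands: "lands h0 (Suc j) False y h \<gamma> t" and v: "\<gamma> t = v" and h: "0 \<le> h" "h \<le> w" for h t
  proof -
    obtain k' where k': "k' \<le> t" "first_visit (Sigma_set h0 (Suc j)) \<gamma> k'"
      "v \<notin> flash_domain h0 (Suc j) y h (\<gamma> k')"
      "\<And>s. s \<in> {k'..<t} \<Longrightarrow> \<gamma> s \<in> flash_domain h0 (Suc j) y h (\<gamma> k')"
      using lands v unfolding lands_def by auto
    have "k' = k" using k k'(2) by (auto simp: first_visit_def) (metis linorder_neqE_nat)
    note k' = k'[unfolded this]
    have prev: "(t = k \<and> rpt v = z) \<or>
        (\<exists>u. u \<in> flash_domain h0 (Suc j) y h (\<gamma> k) \<and> norm (rpt u - rpt v) = 1)"
    proof (cases "t = k")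
      case True
      then show ?thesis using v by (simp add: z_def)
    next
      case False
      then obtain s where s: "t = Suc s" "k \<le> s" using k'(1) by (cases t) auto
      then have "norm (rpt (\<gamma> s) - rpt v) = 1" using assms(2) v by (auto simp: nn_path_def nbr_def)
      then show ?thesis using k'(4)[of s] s by auto
    qed
    show ?thesis
    proof (cases y)
      case True
      define \<rho> where "\<rho> = min h (r + w - norm z)"
      have dom: "u \<in> flash_domain h0 (Suc j) y h (\<gamma> k) \<longleftrightarrow> norm (rpt u - z) < \<rho>" for u
        using True by (simp add: flash_domain_def shell_outer_def zball_def dist_norm z_def r_def w_def
            \<rho>_def norm_minus_commute)
      have lower: "\<rho> \<le> norm (rpt v - z)" using k'(3) dom by (simp add: not_less)
      have upper: "norm (rpt v - z) \<le> max 0 (\<rho> + 1)"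
        using prev
      proof (elim disjE exE conjE)
        fix u assume u: "u \<in> flash_domain h0 (Suc j) y h (\<gamma> k)" "norm (rpt u - rpt v) = 1"
        have "norm (rpt v - z) \<le> norm (rpt v - rpt u) + norm (rpt u - z)"
          using norm_triangle_ineq[of "rpt v - rpt u" "rpt u - z"] by simp
        moreover have "norm (rpt u - z) < \<rho>" using u(1) dom by blast
        ultimately show ?thesis using u(2) by (simp add: norm_minus_commute)
      qed simp
      show ?thesis
      proof (cases "h \<le> r + w - norm z")
        case True
        then have "h \<in> {norm (rpt v - z) - 1..norm (rpt v - z)}"
          using lower upper h by (auto simp: \<rho>_def max_def split: if_splits)
        then show ?thesis unfolding C_def by blast
      next
        case False
        then have "h \<in> {w - 1..w}" using z h by auto
        then show ?thesis unfolding C_def by blast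
      qed
    next
      case False
      have dom: "u \<in> flash_domain h0 (Suc j) y h (\<gamma> k) \<longleftrightarrow> r - h \<le> norm (rpt u) \<and> norm (rpt u) < r + h" for u
        using False by (simp add: flash_domain_def annulus_iff r_def)
      have out: "norm (rpt v) < r - h \<or> r + h \<le> norm (rpt v)" using k'(3) dom[of v] by auto
      show ?thesis
        using prev
      proof (elim disjE exE conjE)
        assume "rpt v = z"
        then have "h \<in> {1 - 1..1}" using out z h by auto
        then show ?thesis unfolding C_def by blast
      next
        fix u assume u: "u \<in> flash_domain h0 (Suc j) y h (\<gamma> k)" "norm (rpt u - rpt v) = 1"
        have "\<bar>norm (rpt u) - norm (rpt v)\<bar> \<le> 1" using norm_triangle_ineq3[of "rpt u" "rpt v"] u(2) by simp
        then have "h \<in> {norm (rpt v) - r - 1..norm (rpt v) - r} \<or> h \<in> {r - norm (rpt v) - 1..r - norm (rpt v)}"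
          using out u(1) dom[of u] by auto
        then show ?thesis unfolding C_def by blast
      qed
    qed
  qed
  moreover have "finite C" "card C \<le> 5"
    unfolding C_def
    using card_length[of "[norm (rpt v - z), w, 1, norm (rpt v) - r, r - norm (rpt v)]"] by auto
  ultimately show ?thesis unfolding w_def by (intro that[of C]) auto
qed

section \<open>The part of the cluster inside a shell\<close>

definition inner_landing ::
    "real \<Rightarrow> nat \<Rightarrow> (int ^ 'd) set \<Rightarrow> (nat \<Rightarrow> bool) \<Rightarrow> (nat \<Rightarrow> bool) \<Rightarrow> (nat \<Rightarrow> real)
       \<Rightarrow> (nat \<Rightarrow> int ^ 'd) \<Rightarrow> nat \<Rightarrow> bool" where
  "inner_landing h0 J A x y h \<gamma> t \<longleftrightarrow> (\<exists>j\<le>J. lands h0 j (x j) (y j) (h j) \<gamma> t \<and> \<gamma> t \<notin> A)"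

lemma lands_inside_iff:
  fixes \<gamma> :: "nat \<Rightarrow> int ^ 'd"
  assumes "h0 \<ge> 1" "lands h0 j x y h \<gamma> t"
  shows "\<gamma> t \<in> zball 0 (shell_outer CARD('d) h0 J) \<longleftrightarrow> j \<le> J"
proof
  show "j \<le> J" if "\<gamma> t \<in> zball 0 (shell_outer CARD('d) h0 J)"
    using that lands_in_shell[OF assms(2)] shell_Int_zball[OF assms(1), of J j] by (auto simp: not_less[symmetric])
  show "\<gamma> t \<in> zball 0 (shell_outer CARD('d) h0 J)" if "j \<le> J"
  proof -
    have "shell_outer CARD('d) h0 j \<le> shell_outer CARD('d) h0 J"
      by (rule shell_outer_mono[OF assms(1) _ that]) (simp add: Suc_le_eq)
    then show ?thesis
      using lands_in_shell[OF assms(2)] shell_subset_zball[OF assms(1), of j] zball_mono by blast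
  qed
qed

lemma inner_landing_Int:
  fixes \<gamma> :: "nat \<Rightarrow> int ^ 'd"
  assumes "h0 \<ge> 1"
  shows "inner_landing h0 J (A \<inter> zball 0 (shell_outer CARD('d) h0 J)) x y h \<gamma> t
           \<longleftrightarrow> inner_landing h0 J A x y h \<gamma> t"
  unfolding inner_landing_def using lands_inside_iff[OF assms] by blast

text \<open>By \<open>lands_order\<close> every flash in a shell beyond \<open>J\<close> is later than every flash in a shell up to \<open>J\<close>.\<close>

lemma settle_time_inner_landing:
  fixes \<gamma> :: "nat \<Rightarrow> int ^ 'd"
  assumes "h0 \<ge> 1" "nn_path \<gamma>" "\<And>j. h j \<le> shell_h CARD('d) h0 j"
    and "inner_landing h0 J A x y h \<gamma> s"
  shows "settle_time h0 A x y h \<gamma> = enat (LEAST t. inner_landing h0 J A x y h \<gamma> t)"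
proof -
  define t where "t = (LEAST t. inner_landing h0 J A x y h \<gamma> t)"
  have "inner_landing h0 J A x y h \<gamma> t" unfolding t_def by (rule LeastI) (rule assms(4))
  then obtain i where i: "i \<le> J" "lands h0 i (x i) (y i) (h i) \<gamma> t" "\<gamma> t \<notin> A"
    unfolding inner_landing_def by blast
  have "False" if "s < t" "lands h0 j (x j) (y j) (h j) \<gamma> s" "\<gamma> s \<notin> A" for s j
  proof (cases "j \<le> J")
    case True
    then show ?thesis using that not_less_Least[of s] unfolding t_def inner_landing_def by blast
  next
    case False
    then show ?thesis using lands_order[OF assms(1-3) i(2) that(2)] i(1) that(1) by auto
  qed
  then show ?thesis using i unfolding t_def[symmetric] settle_time_eq_enat_iff by blast
qed

text \<open>The part of the cluster in the ball \<open>B\<close> surrounded by shell \<open>Suc J\<close> evolves autonomously: the next step depends only on this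
part and on the flashes in the shells up to \<open>J\<close>.\<close>

lemma cluster_Suc_inner:
  fixes S :: "nat \<Rightarrow> nat \<Rightarrow> int ^ 'd" and h0 :: real and J :: nat
  defines "B \<equiv> zball 0 (shell_outer CARD('d) h0 J)"
  assumes "h0 \<ge> 1" "nn_path (S i)" "\<And>j. h i j \<le> shell_h CARD('d) h0 j"
  shows "cluster h0 S x y h (Suc i) \<inter> B = cluster h0 S x y h i \<inter> B \<union>
    (let L = inner_landing h0 J (cluster h0 S x y h i \<inter> B) (x i) (y i) (h i) (S i)
     in if Ex L then {S i (LEAST t. L t)} else {})"
proof -
  let ?A = "cluster h0 S x y h i"
  let ?L = "inner_landing h0 J ?A (x i) (y i) (h i) (S i)"
  have L: "inner_landing h0 J (?A \<inter> B) (x i) (y i) (h i) (S i) = ?L"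
    unfolding B_def inner_landing_Int[OF assms(2)] ..
  show ?thesis
  proof (cases "Ex ?L")
    case True
    then obtain s where s: "?L s" by blast
    have "?L (LEAST t. ?L t)" using s by (rule LeastI)
    then have "S i (LEAST t. ?L t) \<in> B"
      unfolding B_def using lands_inside_iff[OF assms(2)] unfolding inner_landing_def by blast
    then show ?thesis
      using settle_time_inner_landing[OF assms(2-4) s] s unfolding L by (auto simp: Let_def)
  next
    case False
    have "S i t \<notin> B" if "settle_time h0 ?A (x i) (y i) (h i) (S i) = enat t" for t
    proof
      assume "S i t \<in> B"
      then have "?L t"
        using that lands_inside_iff[OF assms(2)] unfolding settle_time_eq_enat_iff B_def inner_landing_def by blast
      with False show False by blast
    qed
    then show ?thesis using False unfolding L by (auto simp: Let_def split: enat.splits)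
  qed
qed

text \<open>Hence flags and radii of shells beyond \<open>J\<close> have no influence on the cluster inside. This is what makes
the set of idle explorers independent of the variables of shell \<open>Suc J\<close>.\<close>

lemma cluster_inner_cong:
  fixes S :: "nat \<Rightarrow> nat \<Rightarrow> int ^ 'd"
  assumes "h0 \<ge> 1" "\<And>i. nn_path (S i)"
    and "\<And>i j. h i j \<le> shell_h CARD('d) h0 j" "\<And>i j. h' i j \<le> shell_h CARD('d) h0 j"
    and "\<And>i j. j \<le> J \<Longrightarrow> x i j = x' i j" "\<And>i j. j \<le> J \<Longrightarrow> h i j = h' i j"
  shows "cluster h0 S x y h i \<inter> zball 0 (shell_outer CARD('d) h0 J)
           = cluster h0 S x' y h' i \<inter> zball 0 (shell_outer CARD('d) h0 J)"
proof (induction i)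
  case (Suc i)
  have "inner_landing h0 J A (x i) (y i) (h i) (S i) = inner_landing h0 J A (x' i) (y i) (h' i) (S i)" for A
    unfolding inner_landing_def using assms(5,6) by (intro ext) auto
  then show ?case
    using cluster_Suc_inner[OF assms(1), where S = S and i = i and J = J and x = x and y = y and h = h]
      cluster_Suc_inner[OF assms(1), where S = S and i = i and J = J and x = x' and y = y and h = h']
      assms(2-4) Suc by simp
qed simp

lemma finite_cluster: "finite (cluster h0 S x y h i)"
  by (induction i) (auto simp: Let_def split: enat.splits)

text \<open>Each explorer adds at most one site to \<open>B\<close>, and the idle ones, over which the second summand ranges, add
none.\<close>

lemma card_idle_explorers:
  "card (cluster h0 S x y h N \<inter> B)
     + card {i. i < N \<and> cluster h0 S x y h (Suc i) \<inter> B = cluster h0 S x y h i \<inter> B} \<le> N"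
proof (induction N)
  case (Suc N)
  let ?I = "\<lambda>N. {i. i < N \<and> cluster h0 S x y h (Suc i) \<inter> B = cluster h0 S x y h i \<inter> B}"
  show ?case
  proof (cases "cluster h0 S x y h (Suc N) \<inter> B = cluster h0 S x y h N \<inter> B")
    case True
    have "card (?I (Suc N)) \<le> card (insert N (?I N))"
      by (intro card_mono) (auto simp: less_Suc_eq)
    also have "\<dots> \<le> Suc (card (?I N))" by (rule card_insert_le_m1) auto
    finally show ?thesis using Suc True by simp
  next
    case False
    then have I: "?I (Suc N) = ?I N" by (auto simp: less_Suc_eq)
    have "\<exists>v. cluster h0 S x y h (Suc N) \<inter> B \<subseteq> insert v (cluster h0 S x y h N \<inter> B)"
      by (auto simp: Let_def split: enat.splits)
    then obtain v where "cluster h0 S x y h (Suc N) \<inter> B \<subseteq> insert v (cluster h0 S x y h N \<inter> B)" ..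
    then have "card (cluster h0 S x y h (Suc N) \<inter> B) \<le> card (insert v (cluster h0 S x y h N \<inter> B))"
      by (intro card_mono) (auto simp: finite_cluster simp del: cluster.simps)
    also have "\<dots> \<le> Suc (card (cluster h0 S x y h N \<inter> B))" by (simp add: card_insert_if finite_cluster)
    finally show ?thesis using Suc unfolding I by simp
  qed
qed simp

text \<open>An explorer that settles in shell \<open>Suc J\<close> leaves the cluster inside unchanged, and it can settle there only
by its flash in that shell, because the shells are disjoint.\<close>

lemma shell_site_settled_by_idle_explorer:
  fixes S :: "nat \<Rightarrow> nat \<Rightarrow> int ^ 'd" and h0 :: real and J :: nat
  defines "B \<equiv> zball 0 (shell_outer CARD('d) h0 J)"
  assumes "h0 \<ge> 1" "v \<in> cluster h0 S x y h N" "v \<in> shell h0 (Suc J)"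
  shows "\<exists>i<N. cluster h0 S x y h (Suc i) \<inter> B = cluster h0 S x y h i \<inter> B \<and>
           (\<exists>t. lands h0 (Suc J) (x i (Suc J)) (y i (Suc J)) (h i (Suc J)) (S i) t \<and> S i t = v)"
  using assms(3)
proof (induction N)
  case (Suc N)
  show ?case
  proof (cases "v \<in> cluster h0 S x y h N")
    case True
    then show ?thesis using Suc.IH less_SucI by blast
  next
    case False
    then obtain t where t: "settle_time h0 (cluster h0 S x y h N) (x N) (y N) (h N) (S N) = enat t" "v = S N t"
      using Suc.prems unfolding cluster_Suc_iff by blast
    then obtain j where j: "lands h0 j (x N j) (y N j) (h N j) (S N) t"
      unfolding settle_time_eq_enat_iff by blast
    then have "j = Suc J" using shells_disjoint[OF assms(2) lands_in_shell] assms(4) t(2) by blast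
    moreover have "v \<notin> B" using shell_Int_zball[OF assms(2), of J "Suc J"] assms(4) unfolding B_def by auto
    then have "cluster h0 S x y h (Suc N) \<inter> B = cluster h0 S x y h N \<inter> B" using t by (auto simp: Let_def)
    ultimately show ?thesis using j t(2) by blast
  qed
qed simp

section \<open>Measurability\<close>

lemma pred_countable2:
  fixes f :: "'a \<Rightarrow> 'b :: countable" and g :: "'a \<Rightarrow> 'c :: countable"
  assumes f: "f \<in> N \<rightarrow>\<^sub>M count_space UNIV" and g: "g \<in> N \<rightarrow>\<^sub>M count_space UNIV"
    and P: "\<And>u v. Measurable.pred N (P u v)"
  shows "Measurable.pred N (\<lambda>\<omega>. P (f \<omega>) (g \<omega>) \<omega>)"
  by (rule measurable_compose_countable[OF _ f]) (rule measurable_compose_countable[OF P g])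

lemma pred_mem_count_space:
  assumes "f \<in> N \<rightarrow>\<^sub>M count_space UNIV"
  shows "Measurable.pred N (\<lambda>\<omega>. P (f \<omega>))"
  using assms by (rule measurable_compose) simp

lemma flash_domain_iff:
  fixes z u :: "int ^ 'd"
  shows "u \<in> flash_domain h0 j y h z \<longleftrightarrow>
    (if y then norm (rpt z - rpt u) < h \<and> norm (rpt z - rpt u) < shell_outer CARD('d) h0 j - norm (rpt z)
     else shell_r CARD('d) h0 j - h \<le> norm (rpt u) \<and> norm (rpt u) < shell_r CARD('d) h0 j + h)"
  by (simp add: flash_domain_def annulus_iff zball_def dist_norm)

lemma pred_lands:
  fixes \<gamma> :: "nat \<Rightarrow> 'a \<Rightarrow> int ^ 'd"
  assumes \<gamma>: "\<And>t. \<gamma> t \<in> N \<rightarrow>\<^sub>M count_space UNIV"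
    and [measurable]: "x \<in> N \<rightarrow>\<^sub>M count_space UNIV" "y \<in> N \<rightarrow>\<^sub>M count_space UNIV" "h \<in> borel_measurable N"
  shows "Measurable.pred N (\<lambda>\<omega>. lands h0 j (x \<omega>) (y \<omega>) (h \<omega>) (\<lambda>t. \<gamma> t \<omega>) t)"
proof -
  have [measurable]: "Measurable.pred N (\<lambda>\<omega>. \<gamma> t \<omega> \<in> L)" for t L
    by (rule pred_mem_count_space[OF \<gamma>])
  have [measurable]: "Measurable.pred N (\<lambda>\<omega>. \<gamma> t \<omega> \<in> cell h0 j (\<gamma> k \<omega>))" for t k
    by (rule pred_countable2[OF \<gamma> \<gamma>]) simp
  have [measurable]: "Measurable.pred N (\<lambda>\<omega>. \<gamma> t \<omega> \<in> flash_domain h0 j (y \<omega>) (h \<omega>) (\<gamma> k \<omega>))" for t k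
    by (rule pred_countable2[OF \<gamma> \<gamma>]) (unfold flash_domain_iff, measurable)
  show ?thesis
    unfolding lands_def first_visit_def by measurable
qed

lemma pred_cluster:
  fixes S :: "nat \<Rightarrow> nat \<Rightarrow> 'a \<Rightarrow> int ^ 'd"
  assumes S: "\<And>i t. S i t \<in> N \<rightarrow>\<^sub>M count_space UNIV"
    and x: "\<And>i j. x i j \<in> N \<rightarrow>\<^sub>M count_space UNIV" and y: "\<And>i j. y i j \<in> N \<rightarrow>\<^sub>M count_space UNIV"
    and h: "\<And>i j. h i j \<in> borel_measurable N"
  shows "Measurable.pred N
    (\<lambda>\<omega>. v \<in> cluster h0 (\<lambda>i t. S i t \<omega>) (\<lambda>i j. x i j \<omega>) (\<lambda>i j. y i j \<omega>) (\<lambda>i j. h i j \<omega>) i)"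
proof (induction i arbitrary: v)
  case 0
  show ?case by simp
next
  case (Suc i)
  note [measurable] = Suc.IH
  have [measurable]: "Measurable.pred N (\<lambda>\<omega>. v = S i t \<omega>)" for t v
    by (rule pred_mem_count_space[OF S])
  have [measurable]: "Measurable.pred N (\<lambda>\<omega>. S i t \<omega> \<in>
      cluster h0 (\<lambda>i t. S i t \<omega>) (\<lambda>i j. x i j \<omega>) (\<lambda>i j. y i j \<omega>) (\<lambda>i j. h i j \<omega>) i)" for t
    by (rule measurable_compose_countable[OF Suc.IH S])
  have [measurable]: "Measurable.pred N (\<lambda>\<omega>. lands h0 j (x i j \<omega>) (y i j \<omega>) (h i j \<omega>) (\<lambda>t. S i t \<omega>) t)" for j t
    by (rule pred_lands[OF S x y h])
  show ?case
    unfolding cluster_Suc_iff settle_time_eq_enat_iff by measurable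
qed

section \<open>Freezing part of the randomness\<close>

text \<open>Conditioning on \<open>G\<close> without conditional probabilities: if \<open>G\<close> and \<open>H\<close> are independent, the map
\<open>\<omega> \<mapsto> (\<omega>, \<omega>)\<close> has a product law on \<open>G \<Otimes>\<^sub>M H\<close>, and Fubini's theorem applies. In \<open>\<Phi> a b\<close> the
argument \<open>a\<close> supplies the variables that are frozen and \<open>b\<close> those that remain random.\<close>

lemma (in prob_space) prob_diagonal_le:
  assumes [simp]: "space G = space M" "space H = space M"
    and indep: "indep_set (sets G) (sets H)"
    and \<Phi> [measurable]: "Measurable.pred (G \<Otimes>\<^sub>M H) (\<lambda>p. \<Phi> (fst p) (snd p))"
    and c: "0 \<le> c" "\<And>a. a \<in> space M \<Longrightarrow> prob {b \<in> space M. \<Phi> a b} \<le> c"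
  shows "{\<omega> \<in> space M. \<Phi> \<omega> \<omega>} \<in> events" "prob {\<omega> \<in> space M. \<Phi> \<omega> \<omega>} \<le> c"
proof -
  have sub: "sets G \<subseteq> events" "sets H \<subseteq> events"
    using indep by (auto simp: indep_sets2_eq)
  have idG [measurable]: "(\<lambda>\<omega>. \<omega>) \<in> M \<rightarrow>\<^sub>M G" and idH [measurable]: "(\<lambda>\<omega>. \<omega>) \<in> M \<rightarrow>\<^sub>M H"
    using sub sets.sets_into_space[of _ G] sets.sets_into_space[of _ H]
    by (auto intro!: measurableI simp: Int_absorb2)
  have "{A \<inter> space M | A. A \<in> sets G} = sets G" "{A \<inter> space M | A. A \<in> sets H} = sets H"
    using sets.sets_into_space[of _ G] sets.sets_into_space[of _ H] by (auto simp: Int_absorb2)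
  moreover have "sigma_sets (space M) (sets G) = sets G" "sigma_sets (space M) (sets H) = sets H"
    using sets.sigma_sets_eq[of G] sets.sigma_sets_eq[of H] by simp_all
  ultimately have "indep_var G (\<lambda>\<omega>. \<omega>) H (\<lambda>\<omega>. \<omega>)"
    using indep idG idH unfolding indep_var_eq by (simp add: vimage_def)
  then have pair: "distr M (G \<Otimes>\<^sub>M H) (\<lambda>\<omega>. (\<omega>, \<omega>)) = distr M G (\<lambda>\<omega>. \<omega>) \<Otimes>\<^sub>M distr M H (\<lambda>\<omega>. \<omega>)"
    unfolding indep_var_distribution_eq by simp
  interpret GM: prob_space "distr M G (\<lambda>\<omega>. \<omega>)" by (rule prob_space_distr) (rule idG)
  interpret HM: prob_space "distr M H (\<lambda>\<omega>. \<omega>)" by (rule prob_space_distr) (rule idH)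
  define Q where "Q = {p \<in> space (G \<Otimes>\<^sub>M H). \<Phi> (fst p) (snd p)}"
  have Q [measurable]: "Q \<in> sets (G \<Otimes>\<^sub>M H)" unfolding Q_def by measurable
  have diag: "{\<omega> \<in> space M. \<Phi> \<omega> \<omega>} = (\<lambda>\<omega>. (\<omega>, \<omega>)) -` Q \<inter> space M"
    by (auto simp: Q_def space_pair_measure)
  have diag_meas: "(\<lambda>\<omega>. (\<omega>, \<omega>)) \<in> M \<rightarrow>\<^sub>M G \<Otimes>\<^sub>M H" by measurable
  show "{\<omega> \<in> space M. \<Phi> \<omega> \<omega>} \<in> events"
    unfolding diag by (rule measurable_sets[OF diag_meas Q])
  have "emeasure M {\<omega> \<in> space M. \<Phi> \<omega> \<omega>} = emeasure (distr M (G \<Otimes>\<^sub>M H) (\<lambda>\<omega>. (\<omega>, \<omega>))) Q"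
    unfolding diag using diag_meas Q by (subst emeasure_distr) auto
  also have "\<dots> = (\<integral>\<^sup>+a. emeasure (distr M H (\<lambda>\<omega>. \<omega>)) (Pair a -` Q) \<partial>distr M G (\<lambda>\<omega>. \<omega>))"
    unfolding pair by (rule HM.emeasure_pair_measure_alt)
      (simp add: Q cong: sets_pair_measure_cong)
  also have "\<dots> \<le> (\<integral>\<^sup>+a. ennreal c \<partial>distr M G (\<lambda>\<omega>. \<omega>))"
  proof (intro nn_integral_mono)
    fix a assume "a \<in> space (distr M G (\<lambda>\<omega>. \<omega>))"
    then have a: "a \<in> space M" by simp
    have "Pair a -` Q \<in> sets H" using Q by (rule sets_Pair1)
    then have "emeasure (distr M H (\<lambda>\<omega>. \<omega>)) (Pair a -` Q) = emeasure M (Pair a -` Q \<inter> space M)"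
      by (subst emeasure_distr) auto
    also have "Pair a -` Q \<inter> space M = {b \<in> space M. \<Phi> a b}"
      using a by (auto simp: Q_def space_pair_measure)
    also have "emeasure M \<dots> \<le> ennreal c"
      using c(2)[OF a] by (simp add: emeasure_eq_measure ennreal_leI)
    finally show "emeasure (distr M H (\<lambda>\<omega>. \<omega>)) (Pair a -` Q) \<le> ennreal c" .
  qed
  also have "\<dots> = ennreal c" using GM.emeasure_space_1 by simp
  finally show "prob {\<omega> \<in> space M. \<Phi> \<omega> \<omega>} \<le> c" using c(1) by (simp add: emeasure_eq_measure)
qed

lemma Int_stable_preimages: "Int_stable {f -` B \<inter> \<Omega> | B. B \<in> sets N}"
proof (rule Int_stableI, safe)
  fix B C assume "B \<in> sets N" "C \<in> sets N"
  then show "\<exists>D. f -` B \<inter> \<Omega> \<inter> (f -` C \<inter> \<Omega>) = f -` D \<inter> \<Omega> \<and> D \<in> sets N"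
    by (intro exI[of _ "B \<inter> C"]) auto
qed

section \<open>The probability that a shell is covered\<close>

context flashing_variables
begin

definition source_events :: "source \<Rightarrow> 'a set set" where
  "source_events s = (case s of
             Step i t \<Rightarrow> {(\<lambda>\<omega>. S i (Suc t) \<omega> - S i t \<omega>) -` B \<inter> space M | B. B \<in> sets (count_space UNIV)}
           | FlagX i j \<Rightarrow> {X i j -` B \<inter> space M | B. B \<in> sets (count_space UNIV)}
           | FlagY i j \<Rightarrow> {Y i j -` B \<inter> space M | B. B \<in> sets (count_space UNIV)}
           | Radius i j \<Rightarrow> {R i j -` B \<inter> space M | B. B \<in> sets borel})"

text \<open>The variables of explorer \<open>i\<close> that stay random when the covering of shell \<open>J\<close> is estimated; its flag \<open>Y\<close>
is frozen together with its walk.\<close>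

definition shell_sources :: "nat \<Rightarrow> nat \<Rightarrow> source set" where
  "shell_sources J i = {FlagX i J, Radius i J}"

definition sources_sigma :: "source set \<Rightarrow> 'a measure" where
  "sources_sigma A = sigma (space M) (\<Union>s\<in>A. source_events s)"

lemma source_events_subset: "source_events s \<subseteq> events"
proof -
  have "indep_sets source_events UNIV" using independent unfolding source_events_def .
  then show ?thesis unfolding indep_sets_def by blast
qed

lemma Int_stable_source_events: "Int_stable (source_events s)"
  unfolding source_events_def by (cases s) (simp_all only: source.case Int_stable_preimages)

lemma space_sources_sigma [simp]: "space (sources_sigma A) = space M"
  by (simp add: sources_sigma_def space_measure_of_conv)

lemma sets_sources_sigma: "sets (sources_sigma A) = sigma_sets (space M) (\<Union>s\<in>A. source_events s)"
  unfolding sources_sigma_def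
  using source_events_subset sets.space_closed by (intro sets_measure_of) blast

lemma indep_sources_sigma:
  assumes "disjoint_family_on A K"
  shows "indep_sets (\<lambda>k. sets (sources_sigma (A k))) K"
  unfolding sets_sources_sigma
proof (rule indep_sets_collect_sigma[OF _ _ assms])
  show "indep_sets source_events (\<Union> (A ` K))"
    using independent unfolding source_events_def by (rule indep_sets_mono_index[OF subset_UNIV])
qed (rule Int_stable_source_events)

lemma measurable_sources_sigma:
  assumes "\<And>B. B \<in> sets N \<Longrightarrow> f -` B \<inter> space M \<in> source_events s" "s \<in> A" "f \<in> space M \<rightarrow> space N"
  shows "f \<in> sources_sigma A \<rightarrow>\<^sub>M N"
proof (rule measurableI)
  fix B assume "B \<in> sets N"
  then show "f -` B \<inter> space (sources_sigma A) \<in> sets (sources_sigma A)"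
    unfolding sets_sources_sigma using assms(1,2) by (auto intro!: sigma_sets.Basic)
qed (use assms(3) in auto)

lemma measurable_step: "Step i t \<in> A \<Longrightarrow> (\<lambda>\<omega>. S i (Suc t) \<omega> - S i t \<omega>) \<in> sources_sigma A \<rightarrow>\<^sub>M count_space UNIV"
  by (rule measurable_sources_sigma[of _ _ "Step i t"]) (auto simp: source_events_def)

lemma measurable_X: "FlagX i j \<in> A \<Longrightarrow> X i j \<in> sources_sigma A \<rightarrow>\<^sub>M count_space UNIV"
  by (rule measurable_sources_sigma[of _ _ "FlagX i j"]) (auto simp: source_events_def)

lemma measurable_Y: "FlagY i j \<in> A \<Longrightarrow> Y i j \<in> sources_sigma A \<rightarrow>\<^sub>M count_space UNIV"
  by (rule measurable_sources_sigma[of _ _ "FlagY i j"]) (auto simp: source_events_def)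

lemma measurable_R: "Radius i j \<in> A \<Longrightarrow> R i j \<in> borel_measurable (sources_sigma A)"
  by (rule measurable_sources_sigma[of _ _ "Radius i j"]) (auto simp: source_events_def)

text \<open>The independence assumption speaks of the increments, and \<open>S i 0\<close> vanishes only almost surely. Their sums
are measurable with respect to the increments everywhere and agree almost surely with \<open>S i\<close>.\<close>

definition walk :: "nat \<Rightarrow> nat \<Rightarrow> 'a \<Rightarrow> int ^ 'd" where
  "walk i t \<omega> = (\<Sum>s<t. S i (Suc s) \<omega> - S i s \<omega>)"

lemma walk_eq: "S i 0 \<omega> = 0 \<Longrightarrow> walk i t \<omega> = S i t \<omega>"
  using sum_lessThan_telescope[of "\<lambda>t. S i t \<omega>" t] by (simp add: walk_def)

lemma measurable_walk:
  assumes "\<And>t. Step i t \<in> A"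
  shows "walk i t \<in> sources_sigma A \<rightarrow>\<^sub>M count_space UNIV"
proof (induction t)
  case 0
  show ?case by (simp add: walk_def[abs_def])
next
  case (Suc t)
  have "walk i (Suc t) = (\<lambda>\<omega>. walk i t \<omega> + (S i (Suc t) \<omega> - S i t \<omega>))"
    by (simp add: walk_def[abs_def] fun_eq_iff)
  also have "\<dots> \<in> sources_sigma A \<rightarrow>\<^sub>M count_space UNIV"
    by (rule measurable_compose_countable[OF _ Suc], rule measurable_compose[OF measurable_step]) (auto simp: assms)
  finally show ?case .
qed

lemma finite_neighbours: "finite {e :: int ^ 'd. nbr 0 e}"
  by (rule finite_subset[OF _ finite_zball[of 0 2]]) (auto simp: nbr_def zball_0_iff)

lemma neighbours_nonempty: "{e :: int ^ 'd. nbr 0 e} \<noteq> {}"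
proof -
  have "rpt (axis i 1 :: int ^ 'd) = axis i 1" for i
    by (simp add: rpt_def axis_def vec_eq_iff)
  then have "nbr 0 (axis i 1 :: int ^ 'd)" for i
    by (simp add: nbr_def norm_axis_1)
  then show ?thesis by blast
qed

lemma rpt_diff: "rpt (a - b) = rpt a - rpt b"
  by (simp add: rpt_def vec_eq_iff)

lemma AE_nn_path: "AE \<omega> in M. \<forall>i. nn_path (\<lambda>t. walk i t \<omega>) \<and> (\<forall>t. walk i t \<omega> = S i t \<omega>)"
proof -
  have "AE \<omega> in M. nbr 0 (S i (Suc t) \<omega> - S i t \<omega>)" for i t
  proof -
    have [measurable]: "(\<lambda>\<omega>. S i (Suc t) \<omega> - S i t \<omega>) \<in> M \<rightarrow>\<^sub>M count_space UNIV"
      by (rule measurable_compose_countable[OF _ rv_S[of i t]], rule measurable_compose[OF rv_S]) auto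
    have "AE e in measure_pmf (pmf_of_set {e :: int ^ 'd. nbr 0 e}). nbr 0 e"
      using finite_neighbours neighbours_nonempty by (auto simp: AE_measure_pmf_iff)
    then show ?thesis
      unfolding walk_step[of i t, symmetric] by (subst (asm) AE_distr_iff) auto
  qed
  then have "AE \<omega> in M. \<forall>i. S i 0 \<omega> = 0 \<and> (\<forall>t. nbr 0 (S i (Suc t) \<omega> - S i t \<omega>))"
    using walk_start by (simp add: AE_all_countable)
  then show ?thesis
  proof eventually_elim
    case (elim \<omega>)
    then show ?case
      by (auto simp: walk_eq nn_path_def nbr_def rpt_diff norm_minus_commute)
  qed
qed

text \<open>The density of the radius is largest at the right end of its support, where it equals \<open>d\<close> divided by
\<open>h\<^sub>j\<close>.\<close>

lemma prob_R_le:
  assumes "h0 \<ge> 1"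
  shows "prob {\<omega> \<in> space M. R i j \<omega> \<in> {c - 1..c}} \<le> real CARD('d) / shell_h CARD('d) h0 j"
proof -
  let ?d = "real CARD('d)" let ?w = "shell_h CARD('d) h0 j"
  have w: "?w \<ge> 1" by (rule shell_h_ge_1[OF assms]) (simp add: Suc_le_eq)
  have dens: "?d * h ^ (CARD('d) - 1) / ?w ^ CARD('d) * indicator {0..?w} h \<le> ?d / ?w" for h
  proof (cases "h \<in> {0..?w}")
    case True
    have "h ^ (CARD('d) - 1) / ?w ^ CARD('d) \<le> ?w ^ (CARD('d) - 1) / ?w ^ CARD('d)"
      using True w by (intro divide_right_mono power_mono) auto
    also have "\<dots> = 1 / ?w"
      using w power_Suc[of ?w "CARD('d) - 1"] by (simp add: field_simps)
    finally have "?d * (h ^ (CARD('d) - 1) / ?w ^ CARD('d)) \<le> ?d * (1 / ?w)"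
      by (intro mult_left_mono) auto
    then show ?thesis using True by simp
  qed (use w in auto)
  have "emeasure M (R i j -` {c - 1..c} \<inter> space M)
      = (\<integral>\<^sup>+h. ennreal (?d * h ^ (CARD('d) - 1) / ?w ^ CARD('d) * indicator {0..?w} h) * indicator {c - 1..c} h \<partial>lborel)"
    by (rule distributed_emeasure[OF law_R]) simp
  also have "\<dots> \<le> (\<integral>\<^sup>+h. ennreal (?d / ?w) * indicator {c - 1..c} h \<partial>lborel)"
    using dens by (intro nn_integral_mono mult_right_mono ennreal_leI) auto
  also have "\<dots> = ennreal (?d / ?w)"
    by (subst nn_integral_cmult_indicator) auto
  finally have "ennreal (prob (R i j -` {c - 1..c} \<inter> space M)) \<le> ennreal (?d / ?w)"
    by (simp add: emeasure_eq_measure)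
  then have "prob (R i j -` {c - 1..c} \<inter> space M) \<le> ?d / ?w"
    using w by (subst (asm) ennreal_le_iff) auto
  moreover have "R i j -` {c - 1..c} \<inter> space M = {\<omega> \<in> space M. R i j \<omega> \<in> {c - 1..c}}" by auto
  ultimately show ?thesis by simp
qed

lemma rv_R [measurable]: "R i j \<in> borel_measurable M"
  using law_R[of i j] by (auto simp: distributed_def)

lemma AE_R: "AE \<omega> in M. R i j \<omega> \<in> {0..shell_h CARD('d) h0 j}"
proof (rule AE_I[of _ _ "R i j -` (- {0..shell_h CARD('d) h0 j}) \<inter> space M"])
  show "emeasure M (R i j -` (- {0..shell_h CARD('d) h0 j}) \<inter> space M) = 0"
    by (subst distributed_emeasure[OF law_R]) (auto simp: nn_integral_0_iff_AE indicator_def)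
qed (auto intro!: measurable_sets[OF rv_R])

lemma prob_X:
  assumes "h0 \<ge> 1"
  shows "prob {\<omega> \<in> space M. X i j \<omega>} \<le> 1 / shell_h CARD('d) h0 j"
proof -
  let ?w = "shell_h CARD('d) h0 j"
  have w: "?w \<ge> 1" by (rule shell_h_ge_1[OF assms]) (simp add: Suc_le_eq)
  have le: "?w \<le> ?w ^ CARD('d)" using w self_le_power[of ?w "CARD('d)"] by simp
  have "prob (X i j -` {True} \<inter> space M) = measure (distr M (count_space UNIV) (X i j)) {True}"
    by (subst measure_distr[OF rv_X]) auto
  also have "\<dots> = 1 / ?w ^ CARD('d)"
    unfolding law_X using w le by (subst measure_pmf_single, subst pmf_bernoulli_True) auto
  also have "\<dots> \<le> 1 / ?w" using w le by (intro divide_left_mono) auto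
  also have "X i j -` {True} \<inter> space M = {\<omega> \<in> space M. X i j \<omega>}" by auto
  finally show ?thesis .
qed

text \<open>To land at \<open>v\<close> an explorer needs the flag \<open>X = 1\<close> or a radius in one of the at most five unit intervals of
\<open>flash_radius_near_landing\<close>.\<close>

lemma prob_landing_site_le:
  fixes \<gamma> :: "nat \<Rightarrow> int ^ 'd"
  assumes "h0 \<ge> 1" "nn_path \<gamma>"
  shows "prob {\<omega> \<in> space M. landing_site h0 (Suc j) (X i (Suc j) \<omega>) y (R i (Suc j) \<omega>) \<gamma> = Some v}
           \<le> (1 + 5 * real CARD('d)) / shell_h CARD('d) h0 (Suc j)"
proof -
  let ?w = "shell_h CARD('d) h0 (Suc j)"
  have w: "?w \<ge> 1" by (rule shell_h_ge_1[OF assms(1)]) (simp add: Suc_le_eq)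
  obtain C where C: "finite C" "card C \<le> 5"
    "\<And>h t. lands h0 (Suc j) False y h \<gamma> t \<Longrightarrow> \<gamma> t = v \<Longrightarrow> 0 \<le> h \<Longrightarrow> h \<le> ?w \<Longrightarrow> \<exists>c\<in>C. h \<in> {c - 1..c}"
    by (rule flash_radius_near_landing[OF assms, of j y v]) (rule that)
  have [measurable]: "X i (Suc j) \<in> M \<rightarrow>\<^sub>M count_space UNIV" by (rule rv_X)
  have "prob {\<omega> \<in> space M. landing_site h0 (Suc j) (X i (Suc j) \<omega>) y (R i (Suc j) \<omega>) \<gamma> = Some v}
      \<le> prob ({\<omega> \<in> space M. X i (Suc j) \<omega>} \<union> (\<Union>c\<in>C. {\<omega> \<in> space M. R i (Suc j) \<omega> \<in> {c - 1..c}}))"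
  proof (rule finite_measure_mono_AE)
    show "AE \<omega> in M. \<omega> \<in> {\<omega> \<in> space M. landing_site h0 (Suc j) (X i (Suc j) \<omega>) y (R i (Suc j) \<omega>) \<gamma> = Some v}
        \<longrightarrow> \<omega> \<in> {\<omega> \<in> space M. X i (Suc j) \<omega>} \<union> (\<Union>c\<in>C. {\<omega> \<in> space M. R i (Suc j) \<omega> \<in> {c - 1..c}})"
      using AE_R[of i "Suc j"]
    proof eventually_elim
      case (elim \<omega>)
      then show ?case using C(3)[of "R i (Suc j) \<omega>"] by (cases "X i (Suc j) \<omega>") (auto simp: landing_site_eq_Some_iff)
    qed
    show "{\<omega> \<in> space M. X i (Suc j) \<omega>} \<union> (\<Union>c\<in>C. {\<omega> \<in> space M. R i (Suc j) \<omega> \<in> {c - 1..c}}) \<in> events"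
      using C(1) by (intro sets.Un sets.finite_UN) measurable
  qed
  also have "\<dots> \<le> prob {\<omega> \<in> space M. X i (Suc j) \<omega>} + prob (\<Union>c\<in>C. {\<omega> \<in> space M. R i (Suc j) \<omega> \<in> {c - 1..c}})"
    using C(1) by (intro measure_Un_le sets.finite_UN) measurable
  also have "\<dots> \<le> 1 / ?w + (\<Sum>c\<in>C. prob {\<omega> \<in> space M. R i (Suc j) \<omega> \<in> {c - 1..c}})"
    using C(1) by (intro add_mono prob_X assms finite_measure_subadditive_finite) auto
  also have "\<dots> \<le> 1 / ?w + (\<Sum>c\<in>C. real CARD('d) / ?w)"
    by (intro add_left_mono sum_mono prob_R_le assms)
  also have "\<dots> \<le> 1 / ?w + 5 * (real CARD('d) / ?w)"
    using C(2) w by (intro add_left_mono) (auto intro!: divide_right_mono mult_right_mono)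
  also have "\<dots> = (1 + 5 * real CARD('d)) / ?w" by (simp add: add_divide_distrib)
  finally show ?thesis .
qed

text \<open>For fixed walks and flags \<open>Y\<close> the landing sites of different explorers depend on disjoint sets of sources,
so the occupancy bound applies once the shell is wide enough for all atoms to be at most \<open>1/2\<close>.\<close>

lemma prob_shell_occupied_le:
  fixes \<gamma> :: "nat \<Rightarrow> nat \<Rightarrow> int ^ 'd" and T :: "(int ^ 'd) set"
  assumes "h0 \<ge> 1" "2 * (1 + 5 * real CARD('d)) \<le> shell_h CARD('d) h0 (Suc j)"
    and \<gamma>: "\<And>i. nn_path (\<gamma> i)" and "finite I" "finite T" "T \<noteq> {}"
  shows "prob {\<omega> \<in> space M. \<forall>v\<in>T. \<exists>i\<in>I.
            landing_site h0 (Suc j) (X i (Suc j) \<omega>) (y i) (R i (Suc j) \<omega>) (\<gamma> i) = Some v}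
           \<le> exp (2 * real (card I) / real (card T)) / real (card T)"
proof -
  define F where "F i \<omega> = landing_site h0 (Suc j) (X i (Suc j) \<omega>) (y i) (R i (Suc j) \<omega>) (\<gamma> i)" for i \<omega>
  let ?G = "\<lambda>i. sources_sigma (shell_sources (Suc j) i)"
  have F: "F i \<in> ?G i \<rightarrow>\<^sub>M count_space UNIV" for i
  proof -
    have [measurable]: "Measurable.pred (?G i) (\<lambda>\<omega>. lands h0 (Suc j) (X i (Suc j) \<omega>) (y i) (R i (Suc j) \<omega>) (\<gamma> i) t)" for t
      by (rule pred_lands) (auto intro!: measurable_X measurable_R simp: shell_sources_def)
    have Some_meas [measurable]: "Measurable.pred (?G i) (\<lambda>\<omega>. F i \<omega> = Some v)" for v
      unfolding F_def landing_site_eq_Some_iff by measurable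
    have "Measurable.pred (?G i) (\<lambda>\<omega>. \<forall>v. F i \<omega> \<noteq> Some v)" by measurable
    then have "Measurable.pred (?G i) (\<lambda>\<omega>. F i \<omega> = None)" by (simp only: not_Some_eq)
    then have "Measurable.pred (?G i) (\<lambda>\<omega>. F i \<omega> = a)" for a
      using Some_meas by (cases a) auto
    then have "F i -` {a} \<inter> space (?G i) \<in> sets (?G i)" for a
      by (simp add: pred_def vimage_def Int_def conj_commute)
    then show ?thesis by (subst measurable_count_space_eq_countable) auto
  qed
  have indep: "indep_sets (\<lambda>i. sets (?G i)) UNIV"
    by (rule indep_sources_sigma) (auto simp: disjoint_family_on_def shell_sources_def)
  have ev: "sets (?G i) \<subseteq> events" for i using indep unfolding indep_sets_def by blast
  have "indep_vars (\<lambda>_. count_space UNIV) F I"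
    unfolding indep_vars_def2
  proof (intro conjI ballI)
    show "F i \<in> M \<rightarrow>\<^sub>M count_space UNIV" for i
      using measurable_sets[OF F[of i]] ev[of i] by (intro measurableI) auto
    show "indep_sets (\<lambda>i. {F i -` A \<inter> space M | A. A \<in> sets (count_space UNIV)}) I"
      using measurable_sets[OF F] by (intro indep_sets_mono[OF indep]) auto
  qed
  moreover have "prob {\<omega> \<in> space M. F i \<omega> = v} \<le> 1 / 2" if "v \<in> Some ` T" for i v
  proof -
    from that obtain u where u: "v = Some u" by blast
    have "prob {\<omega> \<in> space M. F i \<omega> = v} \<le> (1 + 5 * real CARD('d)) / shell_h CARD('d) h0 (Suc j)"
      unfolding F_def u by (rule prob_landing_site_le[OF assms(1) \<gamma>])
    also have "\<dots> \<le> 1 / 2" using assms(2) by (simp add: field_simps)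
    finally show ?thesis .
  qed
  ultimately have "prob {\<omega> \<in> space M. \<forall>v\<in>Some ` T. \<exists>i\<in>I. F i \<omega> = v}
      \<le> exp (2 * real (card I) / real (card (Some ` T))) / real (card (Some ` T))"
    using assms(4-6) by (intro prob_all_occupied_le) auto
  then show ?thesis by (simp add: F_def card_image)
qed

text \<open>If \<open>B\<close> is covered then at most \<open>N - card B\<close> explorers are idle, and they alone have to fill \<open>T\<close> by their
flashes there. So, up to a null set, the covering event is contained in the event \<open>Q\<close> that the flashes
of at most \<open>N - card B\<close> idle explorers fill \<open>T\<close>.\<close>

lemma prob_covered_le:
  fixes J N :: nat
  defines "B \<equiv> zball 0 (shell_outer CARD('d) h0 J) :: (int ^ 'd) set"
    and "T \<equiv> shell h0 (Suc J) :: (int ^ 'd) set"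
  defines "c \<equiv> exp (2 * real (N - card B) / real (card T)) / real (card T)"
  assumes h0: "h0 \<ge> 1" and wide: "2 * (1 + 5 * real CARD('d)) \<le> shell_h CARD('d) h0 (Suc J)"
    and T: "T \<noteq> {}"
  shows "\<exists>Q\<in>events. prob Q \<le> c \<and> (AE \<omega> in M.
    B \<union> T \<subseteq> cluster h0 (\<lambda>i t. S i t \<omega>) (\<lambda>i j. X i j \<omega>) (\<lambda>i j. Y i j \<omega>) (\<lambda>i j. R i j \<omega>) N
      \<longrightarrow> \<omega> \<in> Q)"
proof -
  \<comment> \<open>The flag and the radius of shell \<open>Suc J\<close> are replaced by constants, which does not change the cluster
inside \<open>B\<close> but makes it a function of the frozen variables only.\<close>
  define D where "D a i = cluster h0 (\<lambda>i t. walk i t a) (\<lambda>i j. j \<noteq> Suc J \<and> X i j a) (\<lambda>i j. Y i j a)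
      (\<lambda>i j. if j = Suc J then 0 else R i j a) i" for a i
  define idle where "idle a i \<longleftrightarrow> D a (Suc i) \<inter> B = D a i \<inter> B" for a i
  define good where "good a \<longleftrightarrow> (\<forall>i. nn_path (\<lambda>t. walk i t a))" for a
  define site where "site i a b = landing_site h0 (Suc J) (X i (Suc J) b) (Y i (Suc J) a) (R i (Suc J) b) (\<lambda>t. walk i t a)"
    for i a b
  define \<I> where "\<I> = {I. I \<subseteq> {..<N} \<and> card I \<le> N - card B}"
  define \<Phi> where "\<Phi> a b \<longleftrightarrow> good a \<and> (\<exists>I\<in>\<I>. (\<forall>i\<in>{..<N}. i \<in> I \<longleftrightarrow> idle a i) \<and> (\<forall>v\<in>T. \<exists>i\<in>I. site i a b = Some v))"
    for a b
  define fresh where "fresh = (\<Union>i. shell_sources (Suc J) i)"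
  let ?G = "sources_sigma (- fresh)" let ?H = "sources_sigma fresh"
  have fin: "finite T" "finite B" "finite \<I>"
    unfolding T_def B_def \<I>_def by (auto simp: shell_Suc[OF h0] finite_annulus finite_zball)
  have mem: "Step i t \<in> - fresh" "FlagY i j \<in> - fresh" "j \<noteq> Suc J \<Longrightarrow> FlagX i j \<in> - fresh"
    "j \<noteq> Suc J \<Longrightarrow> Radius i j \<in> - fresh" "FlagX i (Suc J) \<in> fresh" "Radius i (Suc J) \<in> fresh" for i j t
    by (auto simp: fresh_def shell_sources_def)
  have walk [measurable]: "walk i t \<in> ?G \<rightarrow>\<^sub>M count_space UNIV" for i t
    by (rule measurable_walk) (rule mem)
  have Y [measurable]: "Y i j \<in> ?G \<rightarrow>\<^sub>M count_space UNIV" for i j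
    by (rule measurable_Y) (rule mem)
  have D [measurable]: "Measurable.pred ?G (\<lambda>a. v \<in> D a i)" for v i
    unfolding D_def
  proof (rule pred_cluster)
    show "(\<lambda>a. j \<noteq> Suc J \<and> X i j a) \<in> ?G \<rightarrow>\<^sub>M count_space UNIV" for i j
      using measurable_X[OF mem(3)[of j i]] by (cases "j = Suc J") auto
    show "(\<lambda>a. if j = Suc J then 0 else R i j a) \<in> borel_measurable ?G" for i j
      using measurable_R[OF mem(4)[of j i]] by (cases "j = Suc J") auto
  qed (rule walk Y)+
  have idle_meas: "Measurable.pred ?G (\<lambda>a. idle a i)" for i
  proof -
    have "idle a i \<longleftrightarrow> (\<forall>v\<in>B. v \<in> D a (Suc i) \<longleftrightarrow> v \<in> D a i)" for a
      unfolding idle_def by blast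
    then show ?thesis using fin by simp
  qed
  have good_meas: "Measurable.pred ?G good"
  proof -
    have [measurable]: "Measurable.pred ?G (\<lambda>a. nbr (walk i t a) (walk i (Suc t) a))" for i t
      by (rule pred_countable2[OF walk walk]) simp
    have [measurable]: "Measurable.pred ?G (\<lambda>a. walk i 0 a = 0)" for i
      by (rule pred_mem_count_space[OF walk])
    show ?thesis unfolding good_def[abs_def] nn_path_def by measurable
  qed
  have site_meas: "Measurable.pred (?G \<Otimes>\<^sub>M ?H) (\<lambda>p. site i (fst p) (snd p) = Some v)" for i v
  proof -
    have [measurable]: "(\<lambda>p. walk i t (fst p)) \<in> ?G \<Otimes>\<^sub>M ?H \<rightarrow>\<^sub>M count_space UNIV" for t
      by (rule measurable_compose[OF measurable_fst walk])
    have [measurable]: "Measurable.pred (?G \<Otimes>\<^sub>M ?H) (\<lambda>p. lands h0 (Suc J) (X i (Suc J) (snd p))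
        (Y i (Suc J) (fst p)) (R i (Suc J) (snd p)) (\<lambda>t. walk i t (fst p)) t)" for t
      by (rule pred_lands measurable_compose[OF measurable_fst] measurable_compose[OF measurable_snd]
          walk Y measurable_X measurable_R mem)+
    have [measurable]: "Measurable.pred (?G \<Otimes>\<^sub>M ?H) (\<lambda>p. walk i t (fst p) = v)" for t
      by (rule pred_mem_count_space[OF measurable_compose[OF measurable_fst walk]])
    show ?thesis unfolding site_def landing_site_eq_Some_iff by measurable
  qed
  have \<Phi>_meas: "Measurable.pred (?G \<Otimes>\<^sub>M ?H) (\<lambda>p. \<Phi> (fst p) (snd p))"
  proof -
    note [measurable] = site_meas measurable_compose[OF measurable_fst idle_meas]
      measurable_compose[OF measurable_fst good_meas]
    have "finite I" if "I \<in> \<I>" for I using that unfolding \<I>_def by (auto intro: finite_subset)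
    then show ?thesis
      unfolding \<Phi>_def using fin
      by (intro pred_intros_logic pred_intros_finite) measurable
  qed
  have indep: "indep_set (sets ?G) (sets ?H)"
  proof -
    have "indep_sets (\<lambda>k. sets (sources_sigma (case_bool (- fresh) fresh k))) UNIV"
      by (rule indep_sources_sigma) (auto simp: disjoint_family_on_def split: bool.splits)
    moreover have "(\<lambda>k. sets (sources_sigma (case_bool (- fresh) fresh k))) = case_bool (sets ?G) (sets ?H)"
      by (auto split: bool.splits)
    ultimately show ?thesis unfolding indep_set_def by simp
  qed
  have bound: "prob {b \<in> space M. \<Phi> a b} \<le> c" for a
  proof (cases "good a \<and> {i \<in> {..<N}. idle a i} \<in> \<I>")
    case True
    define I where "I = {i \<in> {..<N}. idle a i}"
    have "I = I'" if "I' \<in> \<I>" "\<forall>i\<in>{..<N}. i \<in> I' \<longleftrightarrow> idle a i" for I'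
      using that unfolding I_def \<I>_def by auto
    moreover have "I \<in> \<I>" "good a" "\<forall>i\<in>{..<N}. i \<in> I \<longleftrightarrow> idle a i"
      using True unfolding I_def by blast+
    ultimately have "\<Phi> a b \<longleftrightarrow> (\<forall>v\<in>T. \<exists>i\<in>I. site i a b = Some v)" for b
      unfolding \<Phi>_def by blast
    then have "{b \<in> space M. \<Phi> a b} = {b \<in> space M. \<forall>v\<in>T. \<exists>i\<in>I. site i a b = Some v}" by simp
    also have "prob \<dots> \<le> exp (2 * real (card I) / real (card T)) / real (card T)"
      unfolding site_def using \<open>good a\<close> fin T
      by (intro prob_shell_occupied_le[OF h0 wide]) (auto simp: good_def I_def)
    also have "\<dots> \<le> c"
      using \<open>I \<in> \<I>\<close> unfolding c_def \<I>_def by (intro divide_right_mono) (auto intro!: divide_right_mono)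
    finally show ?thesis .
  next
    case False
    have "I' = {i \<in> {..<N}. idle a i}" if "I' \<in> \<I>" "\<forall>i\<in>{..<N}. i \<in> I' \<longleftrightarrow> idle a i" for I'
      using that unfolding \<I>_def by auto
    then have empty: "{b \<in> space M. \<Phi> a b} = {}" using False unfolding \<Phi>_def by blast
    show ?thesis unfolding empty by (simp add: c_def)
  qed
  define Q where "Q = {\<omega> \<in> space M. \<Phi> \<omega> \<omega>}"
  have "c \<ge> 0" by (simp add: c_def)
  note Q = prob_diagonal_le[OF space_sources_sigma space_sources_sigma indep \<Phi>_meas this bound, folded Q_def]
  have "AE \<omega> in M. \<forall>i j. R i j \<omega> \<in> {0..shell_h CARD('d) h0 j}"
    using AE_R by (simp only: AE_all_countable) blast
  then have "AE \<omega> in M.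
    B \<union> T \<subseteq> cluster h0 (\<lambda>i t. S i t \<omega>) (\<lambda>i j. X i j \<omega>) (\<lambda>i j. Y i j \<omega>) (\<lambda>i j. R i j \<omega>) N \<longrightarrow> \<omega> \<in> Q"
    using AE_nn_path AE_space
  proof eventually_elim
    case (elim \<omega>)
    let ?C = "cluster h0 (\<lambda>i t. S i t \<omega>) (\<lambda>i j. X i j \<omega>) (\<lambda>i j. Y i j \<omega>) (\<lambda>i j. R i j \<omega>)"
    have walk_S: "(\<lambda>i t. walk i t \<omega>) = (\<lambda>i t. S i t \<omega>)" "\<And>i. (\<lambda>t. walk i t \<omega>) = (\<lambda>t. S i t \<omega>)"
      using elim(2) by auto
    have w0: "0 \<le> shell_h CARD('d) h0 j" for j
      using shell_h_ge_1[OF h0, of "CARD('d)" j] by (simp add: Suc_le_eq)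
    have inner: "?C i \<inter> B = D \<omega> i \<inter> B" for i
      unfolding D_def B_def walk_S
      by (rule cluster_inner_cong[OF h0]) (use elim w0 in \<open>auto simp: walk_S\<close>)
    show ?case
    proof
      assume cover: "B \<union> T \<subseteq> ?C N"
      define I where "I = {i. i < N \<and> ?C (Suc i) \<inter> B = ?C i \<inter> B}"
      have "?C N \<inter> B = B" using cover by blast
      then have "card I \<le> N - card B"
        using card_idle_explorers[of h0 "\<lambda>i t. S i t \<omega>" "\<lambda>i j. X i j \<omega>" "\<lambda>i j. Y i j \<omega>" "\<lambda>i j. R i j \<omega>" N B]
        unfolding I_def by simp
      then have "I \<in> \<I>" unfolding \<I>_def I_def by auto
      moreover have "\<forall>i\<in>{..<N}. i \<in> I \<longleftrightarrow> idle \<omega> i" unfolding I_def idle_def inner by auto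
      moreover have "\<forall>v\<in>T. \<exists>i\<in>I. site i \<omega> \<omega> = Some v"
      proof
        fix v assume "v \<in> T"
        then show "\<exists>i\<in>I. site i \<omega> \<omega> = Some v"
          using shell_site_settled_by_idle_explorer[OF h0, of v "\<lambda>i t. S i t \<omega>" "\<lambda>i j. X i j \<omega>"
              "\<lambda>i j. Y i j \<omega>" "\<lambda>i j. R i j \<omega>" N J] cover
          unfolding I_def B_def T_def site_def landing_site_eq_Some_iff walk_S by blast
      qed
      moreover have "good \<omega>" using elim unfolding good_def by blast
      ultimately show "\<omega> \<in> Q" using elim unfolding Q_def \<Phi>_def by blast
    qed
  qed
  then show ?thesis using Q by blast
qed

end

section \<open>A shell just below a given radius\<close>

context
  fixes h0 :: real and d :: nat
  assumes h0: "h0 \<ge> 1" and d: "d \<ge> 1"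
begin

lemma shell_outer_ge: "real j \<le> shell_outer d h0 j"
proof (induction j)
  case 0
  then show ?case using shell_outer_pos[OF h0 d, of 0] by simp
next
  case (Suc j)
  then show ?case using shell_outer_Suc[OF h0 d, of j] shell_h_ge_1[OF h0 d, of "Suc j"] by simp
qed

lemma shell_containing_radius:
  assumes "shell_outer d h0 1 \<le> a"
  obtains J where "shell_outer d h0 (Suc J) \<le> a" "a < shell_outer d h0 (Suc (Suc J))"
proof -
  obtain k where "a < real k" using reals_Archimedean2 by blast
  then have ex: "a < shell_outer d h0 k" using shell_outer_ge[of k] by linarith
  define m where "m = (LEAST k. a < shell_outer d h0 k)"
  have m: "a < shell_outer d h0 m" unfolding m_def by (rule LeastI) (rule ex)
  have below: "shell_outer d h0 k \<le> a" if "k < m" for k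
    using not_less_Least[of k "\<lambda>k. a < shell_outer d h0 k"] that unfolding m_def by (simp add: not_less)
  have "\<not> m \<le> 1" using m assms shell_outer_mono[OF h0 d, of m 1] by auto
  then obtain J where "m = Suc (Suc J)" by (metis One_nat_def Suc_le_mono le0 not0_implies_Suc)
  then show ?thesis using that[of J] m below[of "Suc J"] by simp
qed

text \<open>Let \<open>J\<close> be such that \<open>n - A * L\<close> lies in shell \<open>Suc (Suc J)\<close>. The widths of the shells \<open>Suc J\<close> and
\<open>Suc (Suc J)\<close> are at most \<open>2 * L\<close> and \<open>4 * L\<close>, so no more than \<open>6 * L\<close> is lost by stepping down to the inner
radius of shell \<open>Suc J\<close>.\<close>

lemma shell_below_radius:
  fixes n A :: real
  defines "L \<equiv> n powr (1 / (real d + 1))"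
  assumes n: "n \<ge> 2" "A \<ge> 0" "(A + 6) * L \<le> n / 2" "shell_outer d h0 1 \<le> n / 2"
  obtains J where "shell_outer d h0 (Suc J) \<le> n - A * L" "n - (A + 6) * L \<le> shell_outer d h0 J"
    "L / 2 \<le> shell_h d h0 (Suc J)"
proof -
  define p where "p = 1 / (real d + 1)"
  have p: "0 < p" "p \<le> 1 / 2" using d by (auto simp: p_def field_simps)
  have L: "L = n powr p" "L \<ge> 0" unfolding L_def p_def by simp_all
  have AL: "A * L \<ge> 0" "6 * L \<ge> 0" "(A + 6) * L = A * L + 6 * L" using n L by (auto simp: algebra_simps)
  obtain J where J: "shell_outer d h0 (Suc J) \<le> n - A * L" "n - A * L < shell_outer d h0 (Suc (Suc J))"
    using shell_containing_radius[of "n - A * L"] AL n by auto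
  have h: "shell_h d h0 (Suc j) = shell_r d h0 (Suc j) powr p" "shell_r d h0 (Suc j) > 1" for j
    unfolding p_def using shell_recursion[OF h0 d] by simp_all
  \<comment> \<open>The width exponent is at most \<open>1/2\<close>, and \<open>sqrt r \<le> r / 2\<close> for \<open>r \<ge> 4\<close>. So half of the radius is already
below the inner radius of this shell, which is at most \<open>n\<close>.\<close>
  have r_bound: "shell_r d h0 (Suc (Suc J)) \<le> 2 * n"
  proof (cases "shell_r d h0 (Suc (Suc J)) \<le> 4")
    case False
    let ?r = "shell_r d h0 (Suc (Suc J))"
    have "?r powr p \<le> ?r powr (1 / 2)" using False p by (intro powr_mono) auto
    also have "\<dots> = sqrt ?r" using False by (simp add: powr_half_sqrt)
    also have "\<dots> \<le> ?r / 2"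
    proof (rule real_le_lsqrt)
      have "?r * 4 \<le> ?r * ?r" using False by (intro mult_left_mono) auto
      then show "?r \<le> (?r / 2)\<^sup>2" by (simp add: power2_eq_square)
    qed (use False in auto)
    finally show ?thesis
      using shell_r_Suc[OF h0 d, of "Suc J"] h(1)[of "Suc J"] J(1) AL by linarith
  qed (use n in auto)
  have "shell_h d h0 (Suc (Suc J)) \<le> (2 * n) powr p"
    unfolding h(1) using r_bound h(2)[of "Suc J"] p by (intro powr_mono2) auto
  also have "\<dots> = 2 powr p * L" using n by (simp add: powr_mult L)
  also have "\<dots> \<le> 2 * L"
    using powr_mono[of p 1 "2 :: real"] p L by (intro mult_right_mono) auto
  finally have h2: "shell_h d h0 (Suc (Suc J)) \<le> 2 * L" .
  have "shell_r d h0 (Suc J) \<le> n"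
    using J(1) AL shell_h_ge_1[OF h0 d, of "Suc J"] by (simp add: shell_outer_def)
  then have h1: "shell_h d h0 (Suc J) \<le> L"
    unfolding h(1) L using h(2)[of J] p by (intro powr_mono2) auto
  have low: "n - (A + 6) * L \<le> shell_outer d h0 J"
    using J(2) shell_outer_Suc[OF h0 d, of "Suc J"] shell_outer_Suc[OF h0 d, of J] h1 h2 AL by linarith
  then have "n / 2 \<le> shell_r d h0 (Suc J)"
    using n shell_r_Suc[OF h0 d, of J] shell_h_ge_1[OF h0 d, of "Suc J"] by linarith
  then have "(n / 2) powr p \<le> shell_h d h0 (Suc J)"
    unfolding h(1) using n p by (intro powr_mono2) auto
  moreover have "(n / 2) powr p = L / 2 powr p" using n by (simp add: powr_divide L)
  moreover have "L / 2 \<le> L / 2 powr p"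
    using powr_mono[of p 1 "2 :: real"] p L by (intro divide_left_mono) auto
  ultimately show ?thesis using that[of J] J(1) low by linarith
qed

end

text \<open>Both annuli begin at a distance \<open>a\<close> of order \<open>n\<close> from the origin. One has width at most
\<open>(A + 6) * L\<close> and the other at least \<open>L\<close>, so \<open>L * n ^ m\<close> bounds the one cardinality from above and the
other from below, up to constants.\<close>

lemma shell_count_ratio:
  fixes n A L :: real and a b :: real
  defines "d \<equiv> real CARD('d)" and "m \<equiv> CARD('d) - 1"
  assumes n: "4 * d \<le> n" "4 * d \<le> L" "0 \<le> A" "n / 2 \<le> a" "n - (A + 6) * L \<le> a" "a \<le> n" "a + L \<le> b"
  shows "unit_ball_vol d * (L / 2 * (n / 4) ^ m) \<le> real (card (annulus a b :: (int ^ 'd) set))"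
    and "real (card (annulus a n :: (int ^ 'd) set))
           \<le> 2 * d * (A + 7) * 8 ^ m * real (card (annulus a b :: (int ^ 'd) set))"
proof -
  have d: "d \<ge> 1" unfolding d_def by (simp add: Suc_le_eq)
  have V: "unit_ball_vol d \<ge> 0" using d by (simp add: less_imp_le)
  have "L / 2 * (n / 4) ^ m \<le> (b - a - 2 * d) * (b - d) ^ m"
    using n d by (intro mult_mono power_mono) auto
  then have "unit_ball_vol d * (L / 2 * (n / 4) ^ m) \<le> unit_ball_vol d * ((b - a - 2 * d) * (b - d) ^ m)"
    using V by (intro mult_left_mono) auto
  also have "\<dots> \<le> real (card (annulus a b :: (int ^ 'd) set))"
    unfolding d_def m_def using n d by (intro card_annulus_lower) (auto simp: d_def)
  finally show lower: "unit_ball_vol d * (L / 2 * (n / 4) ^ m) \<le> real (card (annulus a b :: (int ^ 'd) set))" .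
  have "real (card (annulus a n :: (int ^ 'd) set)) \<le> unit_ball_vol d * (d * (n - a + 2 * d) * (n + d) ^ m)"
    unfolding d_def m_def using n d by (intro card_annulus_upper) (auto simp: d_def)
  also have "\<dots> \<le> unit_ball_vol d * (d * ((A + 7) * L) * (2 * n) ^ m)"
    using V n d by (intro mult_left_mono mult_mono power_mono) (auto simp: algebra_simps)
  also have "\<dots> = 2 * d * (A + 7) * 8 ^ m * (unit_ball_vol d * (L / 2 * (n / 4) ^ m))"
  proof -
    have pow: "(2 * n) ^ m = 8 ^ m * (n / 4) ^ m"
      using power_mult_distrib[of 8 "n / 4" m] by simp
    have "v * (d * ((A + 7) * L) * (e * y)) = 2 * d * (A + 7) * e * (v * (L / 2 * y))" for v e y
      by simp
    then show ?thesis unfolding pow .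
  qed
  also have "\<dots> \<le> 2 * d * (A + 7) * 8 ^ m * real (card (annulus a b :: (int ^ 'd) set))"
    using d n by (intro mult_left_mono lower) auto
  finally show "real (card (annulus a n :: (int ^ 'd) set))
      \<le> 2 * d * (A + 7) * 8 ^ m * real (card (annulus a b :: (int ^ 'd) set))" .
qed

section \<open>Almost sure growth of the inner error\<close>

context flashing_variables
begin

abbreviation "grown_cluster N \<omega> \<equiv>
  cluster h0 (\<lambda>i t. S i t \<omega>) (\<lambda>i j. X i j \<omega>) (\<lambda>i j. Y i j \<omega>) (\<lambda>i j. R i j \<omega>) N"

text \<open>The number of sites in the chosen shell is at least of order \<open>n ^ (CARD('d) - 1)\<close>; this is where
dimension at least three makes the bound summable.\<close>

lemma prob_ball_covered_le:
  fixes A :: nat and L :: "nat \<Rightarrow> real"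
  defines "\<And>n. L n \<equiv> real n powr (1 / (real CARD('d) + 1))"
  assumes h0: "h0 \<ge> 1" and dim: "CARD('d) \<ge> 3"
  obtains c where "c > 0" "\<forall>\<^sub>F n in sequentially. \<exists>Q\<in>events. prob Q \<le> c / real n ^ 2 \<and>
    (AE \<omega> in M. zball 0 (real n - A * L n) \<subseteq> grown_cluster (card (zball 0 (real n) :: (int ^ 'd) set)) \<omega>
       \<longrightarrow> \<omega> \<in> Q)"
proof -
  define d where "d = real CARD('d)"
  define m where "m = CARD('d) - 1"
  define c1 where "c1 = unit_ball_vol d / 4 ^ m"
  define c2 where "c2 = 2 * d * (real A + 7) * 8 ^ m"
  \<comment> \<open>The last two terms ensure \<open>(A + 6) * L n \<le> n / 2\<close>, by way of \<open>L n \<le> sqrt n\<close>, and a shell wide enough for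
the atoms of the flash sites to be at most \<open>1/2\<close>.\<close>
  define n0 where "n0 = max (max (4 * d) 2) (max (2 * shell_outer CARD('d) h0 1)
      (max ((2 * (real A + 6)) ^ 2) ((4 * (1 + 5 * d)) powr (d + 1))))"
  have d: "d \<ge> 3" "1 \<le> CARD('d)" using dim unfolding d_def by auto
  have c1: "c1 > 0" unfolding c1_def using d by simp
  have main: "\<exists>Q\<in>events. prob Q \<le> (exp (2 * c2) / c1) / real n ^ 2 \<and>
    (AE \<omega> in M. zball 0 (real n - A * L n) \<subseteq> grown_cluster (card (zball 0 (real n) :: (int ^ 'd) set)) \<omega>
       \<longrightarrow> \<omega> \<in> Q)" if "n0 \<le> real n" for n
  proof -
    have n: "4 * d \<le> n" "2 \<le> real n" "2 * shell_outer CARD('d) h0 1 \<le> n"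
      "(2 * (real A + 6)) ^ 2 \<le> n" "(4 * (1 + 5 * d)) powr (d + 1) \<le> n"
      using that unfolding n0_def by auto
    have "((4 * (1 + 5 * d)) powr (d + 1)) powr (1 / (d + 1)) \<le> L n"
      unfolding L_def d_def[symmetric] using n(5) d by (intro powr_mono2) auto
    moreover have "((4 * (1 + 5 * d)) powr (d + 1)) powr (1 / (d + 1)) = 4 * (1 + 5 * d)"
      using d by (simp add: powr_powr)
    ultimately have L: "4 * (1 + 5 * d) \<le> L n" by simp
    have "L n \<le> real n powr (1 / 2)"
      unfolding L_def d_def[symmetric] using n d by (intro powr_mono) (auto simp: field_simps)
    then have L_sqrt: "L n \<le> sqrt (real n)" by (simp add: powr_half_sqrt)
    have "2 * (real A + 6) \<le> sqrt (real n)" using n(4) by (rule real_le_rsqrt)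
    then have "2 * (real A + 6) * L n \<le> sqrt (real n) * sqrt (real n)"
      using L_sqrt L d by (intro mult_mono) auto
    then have AL: "(real A + 6) * L n \<le> real n / 2" by (simp add: algebra_simps)
    obtain J where J: "shell_outer CARD('d) h0 (Suc J) \<le> real n - A * L n"
      "real n - (real A + 6) * L n \<le> shell_outer CARD('d) h0 J" "L n / 2 \<le> shell_h CARD('d) h0 (Suc J)"
      unfolding L_def
      by (rule shell_below_radius[OF h0 d(2), of "real n" "real A"])
        (use n AL in \<open>auto simp: L_def\<close>)
    define a where "a = shell_outer CARD('d) h0 J"
    define b where "b = shell_outer CARD('d) h0 (Suc J)"
    have b: "b = a + 2 * shell_h CARD('d) h0 (Suc J)"
      unfolding a_def b_def by (rule shell_outer_Suc[OF h0 d(2)])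
    have ab: "4 * d \<le> L n" "n / 2 \<le> a" "n - (real A + 6) * L n \<le> a" "a \<le> n" "a + L n \<le> b"
    proof -
      have AL_nonneg: "0 \<le> real A * L n" using L d by (intro mult_nonneg_nonneg) auto
      show "4 * d \<le> L n" using L d by simp
      show low: "n - (real A + 6) * L n \<le> a" using J(2) unfolding a_def .
      show "n / 2 \<le> a" using low AL by linarith
      show "a + L n \<le> b" using b J(3) by linarith
      moreover have "b \<le> n - real A * L n" using J(1) unfolding b_def .
      moreover have "0 \<le> L n" using L d by simp
      ultimately show "a \<le> n" using AL_nonneg by linarith
    qed
    let ?B = "zball 0 a :: (int ^ 'd) set" and ?T = "shell h0 (Suc J) :: (int ^ 'd) set"
    let ?N = "card (zball 0 (real n) :: (int ^ 'd) set)"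
    have T: "?T = annulus a b" unfolding a_def b_def by (rule shell_Suc[OF h0])
    have idle: "?N - card ?B = card (annulus a (real n) :: (int ^ 'd) set)"
      using card_annulus[OF ab(4), where 'd = 'd] by simp
    note counts = shell_count_ratio[where 'd = 'd, folded d_def m_def, OF n(1) ab(1) _ ab(2-5)]
    have "c1 * real n ^ 2 \<le> c1 * real n ^ m"
      using c1 n dim by (intro mult_left_mono power_increasing) (auto simp: m_def)
    also have "\<dots> \<le> unit_ball_vol d * (L n / 2 * (n / 4) ^ m)"
    proof -
      have "unit_ball_vol d * (n / 4) ^ m * 1 \<le> unit_ball_vol d * (n / 4) ^ m * (L n / 2)"
        using L d by (intro mult_left_mono) auto
      then show ?thesis by (simp add: c1_def power_divide mult_ac)
    qed
    also have "\<dots> \<le> real (card ?T)" unfolding T by (rule counts(1)) simp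
    finally have T_ge: "c1 * real n ^ 2 \<le> real (card ?T)" .
    moreover have "0 < c1 * real n ^ 2" using c1 n by simp
    ultimately have T_pos: "0 < real (card ?T)" by linarith
    have ratio: "real (?N - card ?B) \<le> c2 * real (card ?T)"
      unfolding T idle c2_def by (rule counts(2)) simp
    obtain Q where Q: "Q \<in> events"
      "prob Q \<le> exp (2 * real (?N - card ?B) / real (card ?T)) / real (card ?T)"
      "AE \<omega> in M. ?B \<union> ?T \<subseteq> grown_cluster ?N \<omega> \<longrightarrow> \<omega> \<in> Q"
    proof -
      have "2 * (1 + 5 * real CARD('d)) \<le> shell_h CARD('d) h0 (Suc J)"
        using L J(3) unfolding d_def by simp
      moreover have "?T \<noteq> {}" using T_pos by auto
      ultimately show ?thesis
        using prob_covered_le[OF h0, of J ?N] that unfolding a_def by blast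
    qed
    have "prob Q \<le> exp (2 * c2) / real (card ?T)"
    proof (rule order_trans[OF Q(2) divide_right_mono])
      show "exp (2 * real (?N - card ?B) / real (card ?T)) \<le> exp (2 * c2)"
        using ratio T_pos by (simp add: divide_le_eq)
    qed simp
    also have "\<dots> \<le> exp (2 * c2) / (c1 * real n ^ 2)"
      using T_ge \<open>0 < c1 * real n ^ 2\<close> T_pos
      by (intro divide_left_mono mult_pos_pos[of "real (card ?T)"] exp_ge_zero)
    finally have "prob Q \<le> (exp (2 * c2) / c1) / real n ^ 2" by simp
    moreover have "AE \<omega> in M. zball 0 (real n - A * L n) \<subseteq> grown_cluster ?N \<omega> \<longrightarrow> \<omega> \<in> Q"
      using Q(3)
    proof eventually_elim
      case (elim \<omega>)
      have "?B \<union> ?T \<subseteq> zball 0 (real n - A * L n)"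
        using J(1) ab(5) L d unfolding T b_def[symmetric] by (auto simp: zball_0_iff annulus_iff)
      then show ?case using elim by blast
    qed
    ultimately show ?thesis using Q(1) by blast
  qed
  have "\<forall>\<^sub>F n in sequentially. n0 \<le> real n"
    using filterlim_real_sequentially by (simp add: filterlim_at_top)
  then have "\<forall>\<^sub>F n in sequentially. \<exists>Q\<in>events. prob Q \<le> (exp (2 * c2) / c1) / real n ^ 2 \<and>
    (AE \<omega> in M. zball 0 (real n - A * L n) \<subseteq> grown_cluster (card (zball 0 (real n) :: (int ^ 'd) set)) \<omega>
       \<longrightarrow> \<omega> \<in> Q)"
    by (rule eventually_mono) (rule main)
  moreover have "0 < exp (2 * c2) / c1" using c1 by simp
  ultimately show ?thesis using that by blast
qed

lemma AE_ball_not_covered: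
  assumes h0: "h0 \<ge> 1" and dim: "CARD('d) \<ge> 3"
  shows "AE \<omega> in M. \<forall>\<^sub>F n in sequentially.
    \<not> zball 0 (real n - real A * real n powr (1 / (real CARD('d) + 1)))
        \<subseteq> grown_cluster (card (zball 0 (real n) :: (int ^ 'd) set)) \<omega>"
proof -
  let ?E = "\<lambda>n \<omega>. zball 0 (real n - real A * real n powr (1 / (real CARD('d) + 1)))
        \<subseteq> grown_cluster (card (zball 0 (real n) :: (int ^ 'd) set)) \<omega>"
  obtain c where c: "c > 0" "\<forall>\<^sub>F n in sequentially. \<exists>Q\<in>events. prob Q \<le> c / real n ^ 2 \<and>
      (AE \<omega> in M. ?E n \<omega> \<longrightarrow> \<omega> \<in> Q)"
    by (rule prob_ball_covered_le[OF assms, of A])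
  then obtain n0 where n0: "\<And>n. n \<ge> n0 \<Longrightarrow> \<exists>Q\<in>events. prob Q \<le> c / real n ^ 2 \<and>
      (AE \<omega> in M. ?E n \<omega> \<longrightarrow> \<omega> \<in> Q)"
    unfolding eventually_sequentially by blast
  define covers where "covers n Q \<longleftrightarrow> (AE \<omega> in M. ?E n \<omega> \<longrightarrow> \<omega> \<in> Q)" for n Q
  have "\<exists>Q. Q \<in> events \<and> (n \<ge> n0 \<longrightarrow> prob Q \<le> c / real n ^ 2 \<and> covers n Q)" for n
    using n0[of n] unfolding covers_def by (cases "n \<ge> n0") auto
  then obtain Q where Q: "\<And>n. Q n \<in> events" "\<And>n. n \<ge> n0 \<Longrightarrow> prob (Q n) \<le> c / real n ^ 2"
    "\<And>n. n \<ge> n0 \<Longrightarrow> covers n (Q n)"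
    by metis
  have "summable (\<lambda>n. c * (1 / real n ^ 2))"
    using inverse_power_summable[of 2, where 'a = real] by (intro summable_mult) (simp add: inverse_eq_divide)
  then have "summable (\<lambda>n. prob (Q n))"
    by (rule summable_comparison_test'[where N = n0]) (use Q(2) in auto)
  then have "AE \<omega> in M. \<forall>\<^sub>F n in sequentially. \<omega> \<in> space M - Q n"
    using Q(1) by (intro borel_cantelli_AE1) (auto simp: emeasure_eq_measure)
  moreover have "AE \<omega> in M. \<forall>n\<ge>n0. ?E n \<omega> \<longrightarrow> \<omega> \<in> Q n"
    using Q(3) unfolding covers_def by (auto simp: AE_all_countable)
  ultimately show ?thesis
  proof eventually_elim
    case (elim \<omega>)
    from elim(1) eventually_ge_at_top[of n0] show ?case
      by eventually_elim (use elim(2) in auto)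
  qed
qed

text \<open>Balls are nested, so if the ball of radius \<open>n - e\<close> is not covered then no larger one is.\<close>

lemma inner_error_ge:
  assumes "\<not> zball 0 (real n - e) \<subseteq> grown_cluster (card (zball 0 (real n) :: (int ^ 'd) set)) \<omega>"
  shows "e \<le> inner_error h0 S X Y R n \<omega>"
proof -
  let ?C = "grown_cluster (card (zball 0 (real n) :: (int ^ 'd) set)) \<omega>"
  have "Sup {r. 0 \<le> r \<and> zball 0 r \<subseteq> ?C} \<le> real n - e"
  proof (rule cSup_least)
    have "0 \<in> {r. 0 \<le> r \<and> zball 0 r \<subseteq> ?C}" by (simp add: zball_def)
    then show "{r. 0 \<le> r \<and> zball 0 r \<subseteq> ?C} \<noteq> {}" by blast
    show "r \<le> real n - e" if "r \<in> {r. 0 \<le> r \<and> zball 0 r \<subseteq> ?C}" for r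
      using that assms zball_mono[of "real n - e" r 0] by (cases "r \<le> real n - e") auto
  qed
  then show ?thesis unfolding inner_error_def by simp
qed

lemma AE_inner_error_dominates:
  assumes "h0 \<ge> 1" "CARD('d) \<ge> 3"
  shows "AE \<omega> in M.
    (\<forall>\<^sub>F n in sequentially. inner_error h0 S X Y R n \<omega> > 0) \<and>
    (\<lambda>n. real n powr (1 / (real CARD('d) + 1)) / inner_error h0 S X Y R n \<omega>) \<longlonglongrightarrow> 0"
proof -
  let ?L = "\<lambda>n. real n powr (1 / (real CARD('d) + 1))"
  have "AE \<omega> in M. \<forall>A::nat. \<forall>\<^sub>F n in sequentially.
      \<not> zball 0 (real n - real A * ?L n) \<subseteq> grown_cluster (card (zball 0 (real n) :: (int ^ 'd) set)) \<omega>"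
    using AE_ball_not_covered[OF assms] by (simp add: AE_all_countable)
  then show ?thesis
  proof eventually_elim
    case (elim \<omega>)
    let ?\<delta> = "\<lambda>n. inner_error h0 S X Y R n \<omega>"
    have ge: "\<forall>\<^sub>F n in sequentially. real A * ?L n \<le> ?\<delta> n \<and> 0 < ?L n" for A :: nat
      using spec[OF elim, of A] eventually_gt_at_top[of 0]
      by eventually_elim (auto intro: inner_error_ge)
    have "\<forall>\<^sub>F n in sequentially. 0 < ?\<delta> n"
      using ge[of 1]
    proof eventually_elim
      case (elim n)
      then have "real 1 * ?L n \<le> ?\<delta> n" "0 < ?L n" by blast+
      then show ?case by linarith
    qed
    moreover have "(\<lambda>n. ?L n / ?\<delta> n) \<longlonglongrightarrow> 0"
    proof (rule tendstoI)
      fix e :: real assume "e > 0"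
      obtain A :: nat where A: "1 / e < real A" using reals_Archimedean2 by blast
      have A_pos: "0 < real A" using A \<open>e > 0\<close> less_trans[of 0 "1 / e" "real A"] by simp
      show "\<forall>\<^sub>F n in sequentially. dist (?L n / ?\<delta> n) 0 < e"
        using ge[of A]
      proof eventually_elim
        case (elim n)
        have "0 < real A * ?L n" using elim A_pos by (intro mult_pos_pos) auto
        moreover from this have pos: "0 < ?\<delta> n" using elim by linarith
        ultimately have "?L n / ?\<delta> n \<le> ?L n / (real A * ?L n)"
          using elim by (intro divide_left_mono mult_pos_pos[of "?\<delta> n"]) auto
        also have "\<dots> = 1 / real A" using elim by simp
        also have "\<dots> < e" using A A_pos \<open>e > 0\<close> by (simp add: field_simps)
        finally show ?case using elim pos by simp
      qed
    qed
    ultimately show ?case by blast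
  qed
qed

end

theorem theorem1p5:
  fixes M :: "'a measure" and h0 :: real
    and S :: "nat \<Rightarrow> nat \<Rightarrow> 'a \<Rightarrow> int ^ 'd"
    and X Y :: "nat \<Rightarrow> nat \<Rightarrow> 'a \<Rightarrow> bool"
    and R :: "nat \<Rightarrow> nat \<Rightarrow> 'a \<Rightarrow> real"
  assumes "CARD('d) \<ge> 3" and "h0 \<ge> 1"
    and "flashing_variables M h0 S X Y R"
  shows "AE \<omega> in M.
           (\<forall>\<^sub>F n in sequentially. inner_error h0 S X Y R n \<omega> > 0) \<and>
           (\<lambda>n. real n powr (1 / (real CARD('d) + 1)) / inner_error h0 S X Y R n \<omega>)
             \<longlonglongrightarrow> 0"
proof -
  interpret flashing_variables M h0 S X Y R by (rule assms(3))
  show ?thesis by (rule AE_inner_error_dominates[OF assms(2,1)])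
qed

end
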